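(* Let $F$ be a holomorphic correspondence of topological degree $d$ on a compact complex manifold $X$. Then there exists an $F^*$-invariant Borel probability measure on $X$.
   Context: Manifolds are connected. Let $X$ be a complex manifold of dimension $k$, and $\pi_1,\pi_2:X\times X\to X$ the two projections. A holomorphic correspondence $F$ on $X$ is given by a holomorphic $k$-chain $\Gamma=\sum_{1\le i\le N}m_i\Gamma_i$, where the $m_i$ are positive integers, the $\Gamma_i$ are distinct irreducible complex subvarieties of $X\times X$ of dimension $k$, and $\pi_1|_{\Gamma_i},\pi_2|_{\Gamma_i}$ are proper, surjective and finite-to-one for each $i$. Put $|\Gamma|=\bigcup_i\Gamma_i$. For $A\subseteq X$, $F^{\dagger}(A):=\pi_1(\pi_2^{-1}(A)\cap|\Gamma|)$; write $F^\dagger(x)$ for $A=\{x\}$. Topological degree: there is a non-empty Zariski-open $\Omega\subseteq X$ over which each $\pi_2|_{\Gamma_i}$ is a $\delta_i$-sheeted holomorphic covering; $d:=\sum_i m_i\delta_i$. For every $x\in X$, $F^\dagger(x)$ consists of $d$ points counted with multiplicity: the multiplicity of $y$ is $\sum_i m_i\,\nu_i(y,x)$, where $\nu_i(y,x)$ is the local degree of $\pi_2|_{\Gamma_i}$ at $(y,x)$ (the number of points of $\Gamma_i$ near $(y,x)$ lying over a generic point $x'$ near $x$; it is $0$ if $(y,x)\notin\Gamma_i$). The symbol $\sum^{\prime}_{y\in F^\dagger(x)}$ denotes the sum over $y$ repeated according to multiplicity. Pullback: for a finite Borel measure $\nu$ on $X$, $F^*\nu$ is the Borel measure with $\langle F^*\nu,\phi\rangle=\int_X\sum^{\prime}_{y\in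 F^\dagger(x)}\phi(y)\,d\nu(x)$ for all compactly supported continuous $\phi$. A Borel probability measure $\mu$ is $F^*$-invariant if $F^*\mu=d\cdot\mu$. *)

theory Defs
  imports
    "HOL-Analysis.Analysis"
    "HOL-Probability.Probability"
    "HOL-Library.Multiset"
begin

section \<open>Holomorphic maps between open subsets of complex Euclidean spaces\<close>

text \<open>
  Points of complex \<open>n\<close>-space are sequences vanishing from index \<open>n\<close> on. This allows the
  dimension to be a natural number (including 0), and the spaces of dimension \<open>j \<le> n\<close> to sit
  inside each other as coordinate subspaces. The product topology on \<^typ>\<open>nat \<Rightarrow> complex\<close>
  induces the Euclidean topology on \<open>Cn n\<close>.
\<close>

definition Cn :: "nat \<Rightarrow> (nat \<Rightarrow> complex) set" where
  "Cn n = {z. \<forall>i\<ge>n. z i = 0}"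

text \<open>
  Total complex differentiability at each point of \<open>S\<close>; used for \<open>S\<close> relatively open in \<open>Cn n\<close>.
\<close>

definition holo_on :: "nat \<Rightarrow> (nat \<Rightarrow> complex) set \<Rightarrow> ((nat \<Rightarrow> complex) \<Rightarrow> complex) \<Rightarrow> bool" where
  "holo_on n S f \<longleftrightarrow>
     (\<forall>z\<in>S. \<exists>a :: nat \<Rightarrow> complex.
        ((\<lambda>w. (f w - f z - (\<Sum>i<n. a i * (w i - z i)))
               / complex_of_real (\<Sum>i<n. norm (w i - z i))) \<longlongrightarrow> 0) (at z within S))"

definition holo_map_on ::
  "nat \<Rightarrow> nat \<Rightarrow> (nat \<Rightarrow> complex) set \<Rightarrow> ((nat \<Rightarrow> complex) \<Rightarrow> nat \<Rightarrow> complex) \<Rightarrow> bool" where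
  "holo_map_on n m S f \<longleftrightarrow> f ` S \<subseteq> Cn m \<and> (\<forall>i<m. holo_on n S (\<lambda>z. f z i))"


section \<open>Complex manifolds\<close>

type_synonym 'a chart = "'a set \<times> ('a \<Rightarrow> nat \<Rightarrow> complex)"

definition complex_chart :: "nat \<Rightarrow> 'a::topological_space chart \<Rightarrow> bool" where
  "complex_chart n = (\<lambda>(U, \<phi>).
     open U \<and> openin (top_of_set (Cn n)) (\<phi> ` U) \<and> (\<exists>\<psi>. homeomorphism U (\<phi> ` U) \<phi> \<psi>))"

definition charts_compatible :: "nat \<Rightarrow> 'a chart \<Rightarrow> 'a chart \<Rightarrow> bool" where
  "charts_compatible n = (\<lambda>(U, \<phi>) (V, \<psi>).
     holo_map_on n n (\<phi> ` (U \<inter> V)) (\<psi> \<circ> inv_into U \<phi>) \<and>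
     holo_map_on n n (\<psi> ` (U \<inter> V)) (\<phi> \<circ> inv_into V \<psi>))"

definition complex_atlas :: "nat \<Rightarrow> 'a::topological_space chart set \<Rightarrow> bool" where
  "complex_atlas n \<A> \<longleftrightarrow>
     (\<forall>c\<in>\<A>. complex_chart n c) \<and> (\<Union>c\<in>\<A>. fst c) = UNIV \<and>
     (\<forall>c\<in>\<A>. \<forall>c'\<in>\<A>. charts_compatible n c c')"

text \<open>
  The underlying space is the whole type; it is Hausdorff and second countable by its sort.
\<close>

definition complex_manifold ::
  "nat \<Rightarrow> 'a::{t2_space, second_countable_topology} chart set \<Rightarrow> bool" where
  "complex_manifold n \<A> \<longleftrightarrow> complex_atlas n \<A> \<and> connected (UNIV :: 'a set)"

definition maximal_atlas :: "nat \<Rightarrow> 'a::topological_space chart set \<Rightarrow> 'a chart set" where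
  "maximal_atlas n \<A> = {c. complex_chart n c \<and> (\<forall>c'\<in>\<A>. charts_compatible n c c')}"

definition Cn_pair :: "nat \<Rightarrow> (nat \<Rightarrow> complex) \<Rightarrow> (nat \<Rightarrow> complex) \<Rightarrow> nat \<Rightarrow> complex" where
  "Cn_pair n z w = (\<lambda>i. if i < n then z i else w (i - n))"

definition product_atlas :: "nat \<Rightarrow> 'a chart set \<Rightarrow> 'b chart set \<Rightarrow> ('a \<times> 'b) chart set" where
  "product_atlas n \<A> \<B> =
     {(U \<times> V, \<lambda>(x, y). Cn_pair n (\<phi> x) (\<psi> y)) | U \<phi> V \<psi>. (U, \<phi>) \<in> \<A> \<and> (V, \<psi>) \<in> \<B>}"

definition holomorphic_fun ::
  "nat \<Rightarrow> 'a::topological_space chart set \<Rightarrow> 'a set \<Rightarrow> ('a \<Rightarrow> complex) \<Rightarrow> bool" where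
  "holomorphic_fun n \<A> W f \<longleftrightarrow>
     (\<forall>(U, \<phi>)\<in>\<A>. holo_on n (\<phi> ` (U \<inter> W)) (f \<circ> inv_into U \<phi>))"

definition holomorphic_map ::
  "nat \<Rightarrow> 'a::topological_space chart set \<Rightarrow> nat \<Rightarrow> 'b::topological_space chart set
     \<Rightarrow> 'a set \<Rightarrow> ('a \<Rightarrow> 'b) \<Rightarrow> bool" where
  "holomorphic_map n \<A> m \<B> W f \<longleftrightarrow>
     continuous_on W f \<and>
     (\<forall>(U, \<phi>)\<in>\<A>. \<forall>(V, \<psi>)\<in>\<B>.
        holo_map_on n m (\<phi> ` (U \<inter> W \<inter> f -` V)) (\<psi> \<circ> f \<circ> inv_into U \<phi>))"


section \<open>Complex subvarieties\<close>

definition analytic_subset ::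
  "nat \<Rightarrow> 'a::topological_space chart set \<Rightarrow> 'a set \<Rightarrow> 'a set \<Rightarrow> bool" where
  "analytic_subset n \<A> W A \<longleftrightarrow>
     open W \<and> A \<subseteq> W \<and>
     (\<forall>p\<in>W. \<exists>V fs. open V \<and> p \<in> V \<and> V \<subseteq> W \<and> finite fs \<and>
        (\<forall>f\<in>fs. holomorphic_fun n \<A> V f) \<and> A \<inter> V = {q \<in> V. \<forall>f\<in>fs. f q = 0})"

definition irreducible_subvariety ::
  "nat \<Rightarrow> 'a::topological_space chart set \<Rightarrow> 'a set \<Rightarrow> bool" where
  "irreducible_subvariety n \<A> A \<longleftrightarrow>
     analytic_subset n \<A> UNIV A \<and> A \<noteq> {} \<and>
     (\<forall>B C. analytic_subset n \<A> UNIV B \<and> analytic_subset n \<A> UNIV C \<and> A = B \<union> C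
        \<longrightarrow> A = B \<or> A = C)"

text \<open>Near \<open>p\<close>, the set \<open>A\<close> is a \<open>j\<close>-dimensional complex submanifold.\<close>

definition regular_point ::
  "nat \<Rightarrow> 'a::topological_space chart set \<Rightarrow> 'a set \<Rightarrow> nat \<Rightarrow> 'a \<Rightarrow> bool" where
  "regular_point n \<A> A j p \<longleftrightarrow>
     p \<in> A \<and> j \<le> n \<and>
     (\<exists>(U, \<phi>)\<in>maximal_atlas n \<A>. p \<in> U \<and> \<phi> ` (A \<inter> U) = \<phi> ` U \<inter> Cn j)"

text \<open>The dimension is the maximal dimension at regular points.\<close>

definition has_dimension ::
  "nat \<Rightarrow> 'a::topological_space chart set \<Rightarrow> 'a set \<Rightarrow> nat \<Rightarrow> bool" where
  "has_dimension n \<A> A k \<longleftrightarrow>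
     (\<exists>p. regular_point n \<A> A k p) \<and> (\<forall>j p. regular_point n \<A> A j p \<longrightarrow> j \<le> k)"


section \<open>Holomorphic correspondences\<close>

text \<open>
  A chain \<open>\<Sum>\<^sub>i m\<^sub>i \<Gamma>\<^sub>i\<close> with distinct \<open>\<Gamma>\<^sub>i\<close> and positive integers \<open>m\<^sub>i\<close> is the multiset in which
  each \<open>\<Gamma>\<^sub>i\<close> occurs \<open>m\<^sub>i\<close> times. Thus \<open>\<Sum>G\<in>#F. f G\<close> is \<open>\<Sum>\<^sub>i m\<^sub>i f(\<Gamma>\<^sub>i)\<close>.
\<close>

type_synonym 'a correspondence = "('a \<times> 'a) set multiset"

abbreviation square_atlas :: "nat \<Rightarrow> 'a chart set \<Rightarrow> ('a \<times> 'a) chart set" where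
  "square_atlas k \<A> \<equiv> product_atlas k \<A> \<A>"

definition holomorphic_correspondence ::
  "nat \<Rightarrow> 'a::topological_space chart set \<Rightarrow> 'a correspondence \<Rightarrow> bool" where
  "holomorphic_correspondence k \<A> F \<longleftrightarrow>
     F \<noteq> {#} \<and>
     (\<forall>G\<in>#F.
        irreducible_subvariety (k + k) (square_atlas k \<A>) G \<and>
        has_dimension (k + k) (square_atlas k \<A>) G k \<and>
        (\<forall>\<pi>\<in>{fst, snd}.
           proper_map (top_of_set G) euclidean \<pi> \<and> \<pi> ` G = UNIV \<and>
           (\<forall>x. finite {p \<in> G. \<pi> p = x})))"

definition corr_support :: "'a correspondence \<Rightarrow> ('a \<times> 'a) set" where
  "corr_support F = \<Union> (set_mset F)"

definition corr_adjoint :: "'a correspondence \<Rightarrow> 'a set \<Rightarrow> 'a set" where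
  "corr_adjoint F A = fst ` (snd -` A \<inter> corr_support F)"


section \<open>Topological degree\<close>

text \<open>
  The second projection restricts to a \<open>\<delta>\<close>-sheeted holomorphic covering of \<open>\<Omega>\<close>: a topological
  covering with fibres of size \<open>\<delta>\<close>, whose total space is near each point the graph of a
  holomorphic local section. The latter says that the total space is a submanifold and the
  projection is locally biholomorphic.
\<close>

definition holomorphic_covering ::
  "nat \<Rightarrow> 'a::topological_space chart set \<Rightarrow> ('a \<times> 'a) set \<Rightarrow> 'a set \<Rightarrow> nat \<Rightarrow> bool" where
  "holomorphic_covering k \<A> G \<Omega> \<delta> \<longleftrightarrow>
     covering_space (G \<inter> snd -` \<Omega>) snd \<Omega> \<and>
     (\<forall>x\<in>\<Omega>. finite {p \<in> G. snd p = x} \<and> card {p \<in> G. snd p = x} = \<delta>) \<and>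
     (\<forall>p \<in> G \<inter> snd -` \<Omega>. \<exists>W T s.
        open W \<and> p \<in> W \<and> open T \<and> T \<subseteq> \<Omega> \<and> holomorphic_map k \<A> k \<A> T s \<and>
        G \<inter> W = {(s x, x) | x. x \<in> T})"

definition zariski_open :: "nat \<Rightarrow> 'a::topological_space chart set \<Rightarrow> 'a set \<Rightarrow> bool" where
  "zariski_open k \<A> \<Omega> \<longleftrightarrow> analytic_subset k \<A> UNIV (- \<Omega>)"

definition topological_degree ::
  "nat \<Rightarrow> 'a::topological_space chart set \<Rightarrow> 'a correspondence \<Rightarrow> nat \<Rightarrow> bool" where
  "topological_degree k \<A> F d \<longleftrightarrow>
     (\<exists>\<Omega> \<delta>. \<Omega> \<noteq> {} \<and> zariski_open k \<A> \<Omega> \<and>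
        (\<forall>G\<in>#F. holomorphic_covering k \<A> G \<Omega> (\<delta> G)) \<and> d = (\<Sum>G\<in>#F. \<delta> G))"


section \<open>Local degrees and multiplicities\<close>

text \<open>
  The number \<open>n\<close> of points of \<open>G\<close> near \<open>p\<close> lying over a generic point near \<open>snd p\<close>. Near \<open>p\<close>
  means in suitable arbitrarily small neighbourhoods \<open>W\<close> of \<open>p\<close>; generic means off a nowhere
  dense analytic subset \<open>Z\<close> of a neighbourhood \<open>V\<close> of \<open>snd p\<close>, which may depend on \<open>W\<close>.
\<close>

definition has_local_degree ::
  "nat \<Rightarrow> 'a::topological_space chart set \<Rightarrow> ('a \<times> 'a) set \<Rightarrow> 'a \<times> 'a \<Rightarrow> nat \<Rightarrow> bool" where
  "has_local_degree k \<A> G p n \<longleftrightarrow>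
     (\<forall>W\<^sub>0. open W\<^sub>0 \<and> p \<in> W\<^sub>0 \<longrightarrow>
        (\<exists>W V Z. open W \<and> p \<in> W \<and> W \<subseteq> W\<^sub>0 \<and> open V \<and> snd p \<in> V \<and>
           analytic_subset k \<A> V Z \<and> interior Z = {} \<and>
           (\<forall>x \<in> V - Z. finite {q \<in> G \<inter> W. snd q = x} \<and> card {q \<in> G \<inter> W. snd q = x} = n)))"

definition local_degree ::
  "nat \<Rightarrow> 'a::topological_space chart set \<Rightarrow> ('a \<times> 'a) set \<Rightarrow> 'a \<times> 'a \<Rightarrow> nat" where
  "local_degree k \<A> G p = (THE n. has_local_degree k \<A> G p n)"

text \<open>Multiplicity of \<open>y\<close> as a point of the fibre of the adjoint over \<open>x\<close>.\<close>

definition adjoint_mult ::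
  "nat \<Rightarrow> 'a::topological_space chart set \<Rightarrow> 'a correspondence \<Rightarrow> 'a \<Rightarrow> 'a \<Rightarrow> nat" where
  "adjoint_mult k \<A> F y x = (\<Sum>G\<in>#F. local_degree k \<A> G (y, x))"

definition adjoint_sum ::
  "nat \<Rightarrow> 'a::topological_space chart set \<Rightarrow> 'a correspondence \<Rightarrow> ('a \<Rightarrow> real) \<Rightarrow> 'a \<Rightarrow> real" where
  "adjoint_sum k \<A> F \<phi> x = (\<Sum>y\<in>corr_adjoint F {x}. real (adjoint_mult k \<A> F y x) * \<phi> y)"


section \<open>Pullback of measures\<close>

text \<open>
  \<open>is_pullback k \<A> F \<nu> \<nu>'\<close> says that \<open>\<nu>'\<close> is the measure \<open>F\<^sup>*\<nu>\<close>. The integrability conditions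
  exclude integrals that are 0 only by convention.
\<close>

definition is_pullback ::
  "nat \<Rightarrow> 'a::topological_space chart set \<Rightarrow> 'a correspondence \<Rightarrow> 'a measure \<Rightarrow> 'a measure \<Rightarrow> bool"
  where
  "is_pullback k \<A> F \<nu> \<nu>' \<longleftrightarrow>
     sets \<nu>' = sets borel \<and>
     (\<forall>\<phi> :: 'a \<Rightarrow> real. continuous_on UNIV \<phi> \<and> compact (closure {x. \<phi> x \<noteq> 0}) \<longrightarrow>
        integrable \<nu>' \<phi> \<and> integrable \<nu> (adjoint_sum k \<A> F \<phi>) \<and>
        (LINT y|\<nu>'. \<phi> y) = (LINT x|\<nu>. adjoint_sum k \<A> F \<phi> x))"

definition pullback_invariant ::
  "nat \<Rightarrow> 'a::topological_space chart set \<Rightarrow> 'a correspondence \<Rightarrow> nat \<Rightarrow> 'a measure \<Rightarrow> bool" where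
  "pullback_invariant k \<A> F d \<mu> \<longleftrightarrow> is_pullback k \<A> F \<mu> (scale_measure (of_nat d) \<mu>)"

end

theory Submission
  imports Defs "HOL-Complex_Analysis.Complex_Analysis"
begin

text \<open>
  The operator \<open>\<phi> \<mapsto> adjoint_sum \<phi>\<close> maps continuous functions to continuous functions, and
  \<open>1\<close> to \<open>d\<close>. Granted this, the Cesaro means of the iterates of its \<open>1/d\<close>-multiple at a point
  have a cluster point among the positive functionals, which is invariant and is represented by a
  measure.

  For the continuity, let \<open>G\<close> be a component of the chain and \<open>\<Omega>\<close> the Zariski-open set over which it
  is a covering. A proper analytic subset of a connected manifold is nowhere dense and does not
  locally disconnect it, so for a small neighbourhood \<open>W\<close> of \<open>p \<in> G\<close> whose closure contains no
  other point of the fibre of \<open>p\<close>, the number of points of \<open>G \<inter> W\<close> over \<open>x \<in> \<Omega>\<close> near \<open>snd p\<close> is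
  constant. It is the local degree of \<open>p\<close>, so the fibre sum at any point is the limit of the fibre
  sums over nearby points of \<open>\<Omega>\<close>, where all local degrees are 1.
\<close>

section \<open>Analytic subsets do not locally disconnect a manifold\<close>

text \<open>The obstacle is the branch locus. The local degree is a definite description, so at a
  branch point its very existence has to be proved, and it is visible only in nearby generic fibres.
  Two one-sided facts meet there. Local sections over \<open>\<Omega>\<close> prevent counts from
  dropping near an unbranched point. Compactness of \<open>G\<close> keeps all fibres near a given
  one inside any prescribed neighbourhood of it, so that no point enters or leaves \<open>W\<close>
  unnoticed. Continuity of fibre sums at points outside \<open>\<Omega>\<close> is never examined
  directly: every comparison passes through a generic point. On the measure side, functionals rather
  than measures are averaged. Linearity, positivity, normalisation and invariance are conditions on
  single values of the functional, so they survive a pointwise limit; countable additivity does not,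
  and is recovered only once, for the limit.\<close>

definition polydisc :: "nat \<Rightarrow> (nat \<Rightarrow> complex) \<Rightarrow> real \<Rightarrow> (nat \<Rightarrow> complex) set" where
  "polydisc n z e = {w \<in> Cn n. \<forall>i<n. norm (w i - z i) < e}"

definition complex_line :: "(nat \<Rightarrow> complex) \<Rightarrow> (nat \<Rightarrow> complex) \<Rightarrow> complex \<Rightarrow> nat \<Rightarrow> complex" where
  "complex_line a b t = (\<lambda>i. a i + t * (b i - a i))"

lemma complex_line_0 [simp]: "complex_line a b 0 = a"
  and complex_line_1 [simp]: "complex_line a b 1 = b"
  by (auto simp: complex_line_def)

lemma complex_line_Cn: "a \<in> Cn n \<Longrightarrow> b \<in> Cn n \<Longrightarrow> complex_line a b t \<in> Cn n"
  by (auto simp: complex_line_def Cn_def)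

lemma continuous_on_complex_line: "continuous_on T (complex_line a b)"
  unfolding complex_line_def
  by (intro continuous_on_coordinatewise_then_product continuous_intros)

lemma open_coordinate_ball: "open {w :: nat \<Rightarrow> complex. norm (w i - c) < e}"
proof -
  have "continuous_on UNIV (\<lambda>w :: nat \<Rightarrow> complex. norm (w i - c))"
    by (intro continuous_intros continuous_on_product_coordinates)
  then show ?thesis
    by (intro open_Collect_less continuous_on_const)
qed

lemma openin_polydisc: "openin (top_of_set (Cn n)) (polydisc n z e)"
proof -
  have "open (\<Inter>i\<in>{..<n}. {w :: nat \<Rightarrow> complex. norm (w i - z i) < e})"
    by (intro open_INT) (auto intro: open_coordinate_ball)
  moreover have "polydisc n z e = Cn n \<inter> (\<Inter>i\<in>{..<n}. {w. norm (w i - z i) < e})"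
    by (auto simp: polydisc_def)
  ultimately show ?thesis unfolding openin_open by blast
qed

text \<open>Sets \<open>X i\<close> are given for all indices, but points of \<open>Cn n\<close>
  agree from index \<open>n\<close> on, so finitely many radii suffice.\<close>

lemma openin_Cn_contains_polydisc:
  assumes "openin (top_of_set (Cn n)) S" "z \<in> S"
  obtains e where "e > 0" "polydisc n z e \<subseteq> S"
proof -
  from assms(1) obtain T where T: "open T" "S = Cn n \<inter> T"
    by (auto simp: openin_open)
  then have "openin (product_topology (\<lambda>i. euclidean) UNIV) T" "z \<in> T"
    using assms(2) by (auto simp: open_fun_def)
  from product_topology_open_contains_basis[OF this]
  obtain X where X: "z \<in> (\<Pi>\<^sub>E i\<in>UNIV. X i)" "\<And>i. open (X i :: complex set)"
    "(\<Pi>\<^sub>E i\<in>UNIV. X i) \<subseteq> T"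
    by auto
  have zX: "z i \<in> X i" for i using X(1) by auto
  have "\<exists>r>0. \<forall>w. norm (w - z i) < r \<longrightarrow> w \<in> X i" for i
    using X(2)[of i] zX[of i] unfolding open_dist dist_norm by blast
  then obtain r where r: "\<And>i. r i > 0" "\<And>i w. norm (w - z i) < r i \<Longrightarrow> w \<in> X i"
    by metis
  \<comment> \<open>The element \<open>1\<close> keeps the minimum over a non-empty set when
    \<open>n = 0\<close>.\<close>
  define e where "e = Min (insert 1 (r ` {..<n}))"
  have "e > 0" unfolding e_def by (subst Min_gr_iff) (auto intro: r)
  have er: "e \<le> r i" if "i < n" for i unfolding e_def using that by (intro Min_le) auto
  have "polydisc n z e \<subseteq> S"
  proof
    fix w assume w: "w \<in> polydisc n z e"
    have "w i \<in> X i" for i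
    proof (cases "i < n")
      case True
      then show ?thesis using w er[of i] r(2)[of "w i" i] by (auto simp: polydisc_def)
    next
      case False
      then have "w i = z i" using w assms(2) T(2) by (auto simp: polydisc_def Cn_def)
      then show ?thesis using zX by simp
    qed
    then have "w \<in> T" using X(3) by auto
    then show "w \<in> S" using w T(2) by (auto simp: polydisc_def)
  qed
  with \<open>e > 0\<close> that show ?thesis by blast
qed

lemma complex_line_polydisc:
  assumes "a \<in> Cn n" "b \<in> Cn n"
  shows "open {t. complex_line a b t \<in> polydisc n z e}"
    and "convex {t. complex_line a b t \<in> polydisc n z e}"
proof -
  have eq: "{t. complex_line a b t \<in> polydisc n z e}
      = (\<Inter>i\<in>{..<n}. {t. norm (a i + t * (b i - a i) - z i) < e})"
    using assms by (auto simp: polydisc_def complex_line_Cn) (auto simp: complex_line_def)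
  show "open {t. complex_line a b t \<in> polydisc n z e}"
    unfolding eq by (intro open_INT ballI open_Collect_less continuous_intros) auto
  show "convex {t. complex_line a b t \<in> polydisc n z e}"
    unfolding eq
  proof (intro convex_INT)
    fix i
    have "{t. norm (a i + t * (b i - a i) - z i) < e}
        = (\<lambda>t. t * (b i - a i)) -` ball (z i - a i) e"
      by (auto simp: dist_norm norm_minus_commute algebra_simps)
    moreover have "linear (\<lambda>t. t * (b i - a i))"
      by (intro bounded_linear.linear bounded_linear_mult_left)
    ultimately show "convex {t. norm (a i + t * (b i - a i) - z i) < e}"
      by (simp add: convex_linear_vimage)
  qed
qed

text \<open>This is the denominator in \<open>holo_on\<close>; it sees only coordinates below
  \<open>n\<close>, hence the restriction to \<open>Cn n\<close>.\<close>

lemma Cn_sum_norm_pos: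
  assumes "a \<in> Cn n" "b \<in> Cn n" "a \<noteq> b"
  shows "(\<Sum>i<n. norm (b i - a i)) > 0"
proof -
  obtain i where i: "a i \<noteq> b i" using assms(3) by auto
  then have "i < n" using assms(1,2) unfolding Cn_def
    by (metis (mono_tags, lifting) mem_Collect_eq not_le)
  then show ?thesis using i by (intro sum_pos2[of _ i]) auto
qed

lemma holo_on_subset: "holo_on n S f \<Longrightarrow> T \<subseteq> S \<Longrightarrow> holo_on n T f"
  unfolding holo_on_def
proof
  fix z assume "z \<in> T" "T \<subseteq> S"
  assume *: "\<forall>z\<in>S. \<exists>a. ((\<lambda>w. (f w - f z - (\<Sum>i<n. a i * (w i - z i)))
               / complex_of_real (\<Sum>i<n. norm (w i - z i))) \<longlongrightarrow> 0) (at z within S)"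
  obtain a where "((\<lambda>w. (f w - f z - (\<Sum>i<n. a i * (w i - z i)))
               / complex_of_real (\<Sum>i<n. norm (w i - z i))) \<longlongrightarrow> 0) (at z within S)"
    using bspec[OF *, of z] \<open>z \<in> T\<close> \<open>T \<subseteq> S\<close> by blast
  from tendsto_within_subset[OF this \<open>T \<subseteq> S\<close>]
  show "\<exists>a. ((\<lambda>w. (f w - f z - (\<Sum>i<n. a i * (w i - z i)))
               / complex_of_real (\<Sum>i<n. norm (w i - z i))) \<longlongrightarrow> 0) (at z within T)"
    by (rule exI[of _ a])
qed

lemma holo_on_imp_continuous_on:
  assumes "holo_on n S f" "S \<subseteq> Cn n"
  shows "continuous_on S f"
  unfolding continuous_on_def
proof
  fix z assume z: "z \<in> S"
  define N where "N w = (\<Sum>i<n. norm (w i - z i))" for w :: "nat \<Rightarrow> complex"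
  from assms(1) z obtain a where a: "((\<lambda>w. (f w - f z - (\<Sum>i<n. a i * (w i - z i)))
      / complex_of_real (N w)) \<longlongrightarrow> 0) (at z within S)"
    unfolding holo_on_def N_def by meson
  have coord: "((\<lambda>w. w i) \<longlongrightarrow> z i) (at z within S)" for i
    using continuous_on_product_coordinates[of i] continuous_on_subset subset_UNIV z
    unfolding continuous_on_def by blast
  have sm: "((\<lambda>w. \<Sum>i<n. a i * (w i - z i)) \<longlongrightarrow> (\<Sum>i<n. a i * (z i - z i))) (at z within S)"
    by (intro tendsto_intros coord)
  have N: "((\<lambda>w. complex_of_real (N w)) \<longlongrightarrow> of_real (\<Sum>i<n. norm (z i - z i))) (at z within S)"
    unfolding N_def by (intro tendsto_intros coord)
  \<comment> \<open>The expression is \<open>f w\<close> itself, rebuilt from its first-order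
    remainder; the cancellation of \<open>N w\<close> is valid off \<open>z\<close>.\<close>
  have "((\<lambda>w. (f w - f z - (\<Sum>i<n. a i * (w i - z i))) / complex_of_real (N w) * complex_of_real (N w)
       + (\<Sum>i<n. a i * (w i - z i)) + f z) \<longlongrightarrow> 0 * of_real (\<Sum>i<n. norm (z i - z i))
        + (\<Sum>i<n. a i * (z i - z i)) + f z) (at z within S)"
    by (intro tendsto_intros a sm N)
  moreover have "\<forall>\<^sub>F w in at z within S. (f w - f z - (\<Sum>i<n. a i * (w i - z i)))
      / complex_of_real (N w) * complex_of_real (N w) + (\<Sum>i<n. a i * (w i - z i)) + f z = f w"
    unfolding eventually_at_filter
  proof (intro always_eventually allI impI)
    fix w assume "w \<noteq> z" "w \<in> S"
    then have "N w > 0" unfolding N_def using assms(2) z by (intro Cn_sum_norm_pos) auto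
    then show "(f w - f z - (\<Sum>i<n. a i * (w i - z i)))
      / complex_of_real (N w) * complex_of_real (N w) + (\<Sum>i<n. a i * (w i - z i)) + f z = f w"
      by simp
  qed
  ultimately show "(f \<longlongrightarrow> f z) (at z within S)"
    by (auto dest: Lim_transform_eventually)
qed

text \<open>The chain rule along an affine map, with one mismatch: \<open>holo_on\<close> divides by
  a positive real number, a complex derivative by \<open>t - s\<close>. The two quotients agree only
  in norm and up to the factor \<open>c\<close>, so the limit is passed through norms.\<close>

lemma holo_on_complex_line:
  assumes f: "holo_on n S f" and a: "a \<in> Cn n" and b: "b \<in> Cn n"
  shows "(\<lambda>t. f (complex_line a b t)) holomorphic_on {t. complex_line a b t \<in> S}"
proof (cases "a = b")
  case True
  then show ?thesis by (simp add: complex_line_def)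
next
  case False
  define L where "L = complex_line a b"
  define A where "A = {t. L t \<in> S}"
  define c where "c = (\<Sum>i<n. norm (b i - a i))"
  have "c > 0" unfolding c_def using Cn_sum_norm_pos[OF a b False] .
  have diff: "L t i - L s i = (t - s) * (b i - a i)" for t s i
    by (simp add: L_def complex_line_def algebra_simps)
  obtain j where j: "a j \<noteq> b j" using False by auto
  have inj: "L t \<noteq> L s" if "t \<noteq> s" for t s
  proof
    assume "L t = L s"
    then have "(t - s) * (b j - a j) = 0" using diff[of t j s] by simp
    then show False using that j by simp
  qed
  have "(\<lambda>t. f (L t)) field_differentiable (at s within A)" if s: "s \<in> A" for s
  proof -
    obtain p where p: "((\<lambda>w. (f w - f (L s) - (\<Sum>i<n. p i * (w i - L s i)))
        / complex_of_real (\<Sum>i<n. norm (w i - L s i))) \<longlongrightarrow> 0) (at (L s) within S)"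
      using f s unfolding holo_on_def A_def by blast
    define D where "D = (\<Sum>i<n. p i * (b i - a i))"
    have "(L \<longlongrightarrow> L s) (at s within A)"
      using continuous_on_complex_line[of A a b] s unfolding continuous_on_def L_def by blast
    \<comment> \<open>Injectivity keeps \<open>L t\<close> away from \<open>L s\<close>, as the
      punctured limit in \<open>holo_on\<close> requires.\<close>
    then have "filterlim L (at (L s) within S) (at s within A)"
      unfolding filterlim_at using inj by (auto simp: eventually_at_filter A_def)
    from filterlim_compose[OF p this]
    have "((\<lambda>t. (f (L t) - f (L s) - (\<Sum>i<n. p i * (L t i - L s i)))
        / complex_of_real (\<Sum>i<n. norm (L t i - L s i))) \<longlongrightarrow> 0) (at s within A)" .
    then have "((\<lambda>t. (f (L t) - f (L s) - (t - s) * D)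
        / complex_of_real (norm (t - s) * c)) \<longlongrightarrow> 0) (at s within A)"
      unfolding diff D_def c_def by (simp add: norm_mult sum_distrib_left mult_ac)
    then have "((\<lambda>t. norm ((f (L t) - f (L s) - (t - s) * D)
        / complex_of_real (norm (t - s) * c)) * c) \<longlongrightarrow> 0 * c) (at s within A)"
      by (intro tendsto_mult tendsto_const tendsto_norm_zero)
    moreover have "\<forall>\<^sub>F t in at s within A. norm ((f (L t) - f (L s) - (t - s) * D)
        / complex_of_real (norm (t - s) * c)) * c = norm ((f (L t) - f (L s)) / (t - s) - D)"
      unfolding eventually_at_filter
    proof (intro always_eventually allI impI)
      fix t assume "t \<noteq> s"
      then have "(f (L t) - f (L s)) / (t - s) - D = (f (L t) - f (L s) - (t - s) * D) / (t - s)"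
        by (simp add: field_simps)
      then show "norm ((f (L t) - f (L s) - (t - s) * D)
        / complex_of_real (norm (t - s) * c)) * c = norm ((f (L t) - f (L s)) / (t - s) - D)"
        using \<open>c > 0\<close> by (simp add: norm_divide norm_mult)
    qed
    ultimately have "((\<lambda>t. norm ((f (L t) - f (L s)) / (t - s) - D)) \<longlongrightarrow> 0) (at s within A)"
      by (auto dest: Lim_transform_eventually)
    then have "((\<lambda>t. (f (L t) - f (L s)) / (t - s)) \<longlongrightarrow> D) (at s within A)"
      using tendsto_norm_zero_iff LIM_zero_iff by blast
    then show ?thesis
      unfolding field_differentiable_def has_field_derivative_iff by blast
  qed
  then show ?thesis unfolding holomorphic_on_def A_def L_def by blast
qed

text \<open>
  Restricting to the complex line through two points reduces the identity theorem and the
  connectedness of the complement of an analytic set to functions of one variable.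
\<close>

lemma countable_zeros_on_line:
  assumes f: "holo_on n (polydisc n z e) f" and a: "a \<in> polydisc n z e" "f a \<noteq> 0"
    and b: "b \<in> polydisc n z e"
  shows "countable {t. complex_line a b t \<in> polydisc n z e \<and> f (complex_line a b t) = 0}"
proof -
  define D where "D = {t. complex_line a b t \<in> polydisc n z e}"
  define g where "g t = f (complex_line a b t)" for t
  have ab: "a \<in> Cn n" "b \<in> Cn n" using a b by (auto simp: polydisc_def)
  note D = complex_line_polydisc[OF ab, of z e, folded D_def]
  have hol: "g holomorphic_on D"
    using holo_on_complex_line[OF f ab] unfolding g_def D_def .
  have 0: "0 \<in> D" "g 0 \<noteq> 0" using a by (auto simp: D_def g_def)
  show ?thesis
  proof (cases "g constant_on D")
    case True
    then have "{t. complex_line a b t \<in> polydisc n z e \<and> f (complex_line a b t) = 0} = {}"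
      using 0 unfolding constant_on_def D_def g_def by (metis (mono_tags, lifting) empty_Collect_eq mem_Collect_eq)
    then show ?thesis by (simp only: countable_empty)
  next
    case False
    have "countable {t\<in>D. g t = 0}"
    proof (rule holomorphic_countable_zeros[OF hol D(1) _ _ False])
      obtain C :: "nat \<Rightarrow> complex set" where "\<And>i. compact (C i)" "\<Union>(range C) = D"
        using open_Union_compact_subsets[OF D(1)] by metis
      then show "fsigma D" using fsigma.intros[of C] compact_imp_closed by auto
    qed (use D(2) convex_connected in blast)
    then show ?thesis by (simp add: D_def g_def)
  qed
qed

text \<open>A single \<open>f\<close> with \<open>f a\<close> non-zero is enough: its zeros on the
  line through \<open>a\<close> and \<open>b\<close>, hence the common zeros of \<open>fs\<close>,
  are countable, and a convex open set in the plane stays connected without them. The image of the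
  remaining parameters joins \<open>a\<close> to \<open>b\<close>.\<close>

lemma connected_polydisc_minus_zeros:
  assumes fs: "\<And>f. f \<in> fs \<Longrightarrow> holo_on n (polydisc n z e) f"
  shows "connected {w \<in> polydisc n z e. \<exists>f\<in>fs. f w \<noteq> 0}" (is "connected ?C")
  unfolding connected_iff_connected_component
proof (intro ballI)
  fix a b assume a: "a \<in> ?C" and b: "b \<in> ?C"
  obtain f where f: "f \<in> fs" "f a \<noteq> 0" using a by blast
  have ab: "a \<in> Cn n" "b \<in> Cn n" using a b by (auto simp: polydisc_def)
  define D where "D = {t. complex_line a b t \<in> polydisc n z e}"
  define K where "K = {t \<in> D. \<forall>f\<in>fs. f (complex_line a b t) = 0}"
  note D = complex_line_polydisc[OF ab, of z e, folded D_def]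
  have "countable {t. complex_line a b t \<in> polydisc n z e \<and> f (complex_line a b t) = 0}"
    using a b f fs by (intro countable_zeros_on_line) auto
  then have "countable K"
    by (rule countable_subset[rotated]) (use f in \<open>auto simp: K_def D_def\<close>)
  then have "connected (D - K)"
    using D by (intro connected_open_diff_countable) (auto simp: convex_connected)
  then have "connected (complex_line a b ` (D - K))"
    by (rule connected_continuous_image[OF continuous_on_complex_line])
  moreover have "complex_line a b ` (D - K) \<subseteq> ?C" by (auto simp: D_def K_def)
  moreover have "0 \<in> D - K" "1 \<in> D - K" using a b by (auto simp: D_def K_def)
  then have "a \<in> complex_line a b ` (D - K)" "b \<in> complex_line a b ` (D - K)"
    by (metis complex_line_0 complex_line_1 imageI)+
  ultimately show "connected_component ?C a b"
    unfolding connected_component_def by blast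
qed

text \<open>If \<open>f b\<close> were non-zero, \<open>f\<close> would have only countably many
  zeros on the line from \<open>b\<close> to a point \<open>a\<close> of \<open>N\<close>. But the
  parameters near \<open>1\<close>, where the line passes through \<open>a\<close>, stay in
  \<open>N\<close>, and they are uncountably many.\<close>

lemma polydisc_identity:
  assumes f: "holo_on n (polydisc n z e) f"
    and N: "openin (top_of_set (Cn n)) N" "N \<subseteq> polydisc n z e" "N \<noteq> {}"
    and zero: "\<And>w. w \<in> N \<Longrightarrow> f w = 0" and b: "b \<in> polydisc n z e"
  shows "f b = 0"
proof (rule ccontr)
  assume nz: "f b \<noteq> 0"
  obtain a where a: "a \<in> N" using N by blast
  obtain r where r: "r > 0" "polydisc n a r \<subseteq> N"
    using openin_Cn_contains_polydisc[OF N(1) a] .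
  have ab: "a \<in> Cn n" "b \<in> Cn n" using a b N by (auto simp: polydisc_def)
  define D where "D = {t. complex_line b a t \<in> polydisc n a r}"
  have "open D" unfolding D_def using complex_line_polydisc ab by blast
  moreover have "1 \<in> D" using ab r by (simp add: D_def polydisc_def)
  ultimately obtain \<delta> where "\<delta> > 0" "ball 1 \<delta> \<subseteq> D" unfolding open_contains_ball by blast
  then have "uncountable D" using uncountable_ball countable_subset by blast
  moreover have "countable {t. complex_line b a t \<in> polydisc n z e \<and> f (complex_line b a t) = 0}"
    using countable_zeros_on_line[OF f b nz subsetD[OF N(2) a]] .
  then have "countable D"
    by (rule countable_subset[rotated]) (use zero r N in \<open>auto simp: D_def\<close>)
  ultimately show False by blast
qed

section \<open>Charts and local equations of analytic sets\<close>

lemma complex_chart_inv: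
  assumes "complex_chart n (U, \<phi>)"
  shows "open U" "inj_on \<phi> U" "\<phi> ` U \<subseteq> Cn n"
    and "homeomorphism U (\<phi> ` U) \<phi> (inv_into U \<phi>)"
    and "\<And>W. open W \<Longrightarrow> W \<subseteq> U \<Longrightarrow> openin (top_of_set (Cn n)) (\<phi> ` W)"
proof -
  obtain \<psi> where U: "open U" "openin (top_of_set (Cn n)) (\<phi> ` U)" "homeomorphism U (\<phi> ` U) \<phi> \<psi>"
    using assms by (auto simp: complex_chart_def)
  show inj: "inj_on \<phi> U"
    by (rule inj_on_inverseI[of _ \<psi>]) (use U(3) in \<open>simp add: homeomorphism_def\<close>)
  show "open U" by fact
  show "\<phi> ` U \<subseteq> Cn n" using openin_imp_subset[OF U(2)] .
  \<comment> \<open>A chart comes with some inverse \<open>\<psi>\<close>, while holomorphy is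
    phrased with \<open>inv_into\<close>; on the chart image they coincide.\<close>
  have eq: "inv_into U \<phi> w = \<psi> w" if "w \<in> \<phi> ` U" for w
    using that inj U(3) by (auto simp: homeomorphism_def)
  show hom: "homeomorphism U (\<phi> ` U) \<phi> (inv_into U \<phi>)"
    using U(3) eq by (auto intro: homeomorphism_cong)
  fix W assume "open W" "W \<subseteq> U"
  then have "openin (top_of_set U) W" by (auto simp: openin_open)
  then have "openin (top_of_set (\<phi> ` U)) (\<phi> ` W)"
    by (rule homeomorphism_imp_open_map[OF hom])
  then show "openin (top_of_set (Cn n)) (\<phi> ` W)" using U(2) openin_trans by blast
qed

lemma atlas_chart_at:
  assumes "complex_atlas n \<A>"
  obtains U \<phi> where "(U, \<phi>) \<in> \<A>" "x \<in> U" "complex_chart n (U, \<phi>)"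
proof -
  have "x \<in> (\<Union>c\<in>\<A>. fst c)" using assms by (simp add: complex_atlas_def)
  then show ?thesis using that assms unfolding complex_atlas_def by fastforce
qed

lemma holomorphic_fun_subset:
  "holomorphic_fun n \<A> W f \<Longrightarrow> W' \<subseteq> W \<Longrightarrow> holomorphic_fun n \<A> W' f"
  unfolding holomorphic_fun_def by (fastforce intro: holo_on_subset)

lemma holomorphic_fun_imp_continuous_on:
  assumes "complex_atlas n \<A>" "holomorphic_fun n \<A> V f" "open V"
  shows "continuous_on V f"
proof -
  have charts: "complex_chart n c" if "c \<in> \<A>" for c
    using assms(1) that by (simp add: complex_atlas_def)
  have "continuous_on (\<Union>c\<in>\<A>. fst c \<inter> V) f"
  proof (rule continuous_on_open_UN)
    fix c assume c: "c \<in> \<A>"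
    obtain U \<phi> where U: "c = (U, \<phi>)" by fastforce
    note ch = complex_chart_inv[OF charts[OF c, unfolded U]]
    show "open (fst c \<inter> V)" using U ch(1) assms(3) by auto
    have "holo_on n (\<phi> ` (U \<inter> V)) (f \<circ> inv_into U \<phi>)"
      using assms(2) c U by (auto simp: holomorphic_fun_def)
    then have "continuous_on (\<phi> ` (U \<inter> V)) (f \<circ> inv_into U \<phi>)"
      by (rule holo_on_imp_continuous_on) (use ch(3) in auto)
    moreover have "continuous_on (U \<inter> V) \<phi>"
      using ch(4) continuous_on_subset[of U \<phi>] by (auto simp: homeomorphism_def)
    ultimately have "continuous_on (U \<inter> V) (f \<circ> inv_into U \<phi> \<circ> \<phi>)"
      by (intro continuous_on_compose[of "U \<inter> V" \<phi> "f \<circ> inv_into U \<phi>"])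
    moreover have "(f \<circ> inv_into U \<phi> \<circ> \<phi>) y = f y" if "y \<in> U \<inter> V" for y
      using that ch(2) by simp
    ultimately show "continuous_on (fst c \<inter> V) f"
      unfolding U fst_conv by (rule continuous_on_eq)
  qed
  moreover have "(\<Union>c\<in>\<A>. fst c \<inter> V) = V"
    using assms(1) by (auto simp: complex_atlas_def)
  ultimately show ?thesis by simp
qed

lemma analytic_subset_local_equations:
  assumes "analytic_subset n \<A> W A" "p \<in> W"
  obtains V fs where "open V" "p \<in> V" "V \<subseteq> W" "finite fs"
    "\<forall>f\<in>fs. holomorphic_fun n \<A> V f" "A \<inter> V = {q \<in> V. \<forall>f\<in>fs. f q = 0}"
proof -
  have "\<exists>V fs. open V \<and> p \<in> V \<and> V \<subseteq> W \<and> finite fs \<and> (\<forall>f\<in>fs. holomorphic_fun n \<A> V f) \<and>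
      A \<inter> V = {q \<in> V. \<forall>f\<in>fs. f q = 0}"
    using assms by (simp add: analytic_subset_def)
  then show ?thesis by (elim exE conjE) (rule that; simp)
qed

lemma open_Diff_analytic_subset:
  assumes "complex_atlas n \<A>" "analytic_subset n \<A> W A"
  shows "open (W - A)"
proof (subst open_subopen, rule ballI)
  fix p assume p: "p \<in> W - A"
  then have "p \<in> W" by blast
  obtain V fs where V: "open V" "p \<in> V" "V \<subseteq> W" "finite fs"
      "\<forall>f\<in>fs. holomorphic_fun n \<A> V f" "A \<inter> V = {q \<in> V. \<forall>f\<in>fs. f q = 0}"
    by (rule analytic_subset_local_equations[OF assms(2) \<open>p \<in> W\<close>])
  then obtain f where f: "f \<in> fs" "f p \<noteq> 0" using p by blast
  have "continuous_on V f"
    using holomorphic_fun_imp_continuous_on[OF assms(1) bspec[OF V(5) f(1)] V(1)] .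
  then have "open (V \<inter> f -` (- {0}))"
    using V(1) by (intro continuous_open_preimage) auto
  then show "\<exists>T. open T \<and> p \<in> T \<and> T \<subseteq> W - A"
    using V f by (intro exI[of _ "V \<inter> f -` (- {0})"]) auto
qed

lemma analytic_subset_restrict:
  assumes "analytic_subset n \<A> W A" "open V" "V \<subseteq> W"
  shows "analytic_subset n \<A> V (A \<inter> V)"
  unfolding analytic_subset_def
proof (intro conjI ballI)
  fix p assume "p \<in> V"
  then have "p \<in> W" using assms(3) by blast
  obtain V' fs where V': "open V'" "p \<in> V'" "V' \<subseteq> W" "finite fs"
      "\<forall>f\<in>fs. holomorphic_fun n \<A> V' f" "A \<inter> V' = {q \<in> V'. \<forall>f\<in>fs. f q = 0}"
    by (rule analytic_subset_local_equations[OF assms(1) \<open>p \<in> W\<close>])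
  then show "\<exists>V' fs. open V' \<and> p \<in> V' \<and> V' \<subseteq> V \<and> finite fs \<and>
        (\<forall>f\<in>fs. holomorphic_fun n \<A> V' f) \<and> A \<inter> V \<inter> V' = {q \<in> V'. \<forall>f\<in>fs. f q = 0}"
  proof (intro exI[of _ "V' \<inter> V"] exI[of _ fs] conjI ballI)
    show "holomorphic_fun n \<A> (V' \<inter> V) f" if "f \<in> fs" for f
      by (rule holomorphic_fun_subset[OF bspec[OF V'(5) that]]) blast
  qed (use V' \<open>p \<in> V\<close> assms(2) in auto)
qed (use assms in auto)

lemma analytic_subset_empty: "open V \<Longrightarrow> analytic_subset n \<A> V {}"
  unfolding analytic_subset_def
proof (intro conjI ballI)
  fix p assume "open V" "p \<in> V"
  have "holomorphic_fun n \<A> V (\<lambda>_. 1)"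
    unfolding holomorphic_fun_def holo_on_def by (auto intro!: exI[of _ "\<lambda>_. 0"])
  then show "\<exists>V' fs. open V' \<and> p \<in> V' \<and> V' \<subseteq> V \<and> finite fs \<and>
      (\<forall>f\<in>fs. holomorphic_fun n \<A> V' f) \<and> {} \<inter> V' = {q \<in> V'. \<forall>f\<in>fs. f q = 0}"
    using \<open>open V\<close> \<open>p \<in> V\<close>
    by (intro exI[of _ V] exI[of _ "{\<lambda>_. 1}"]) auto
qed auto

text \<open>The neighbourhood is a polydisc in a chart, small enough to carry equations for
  \<open>A\<close>. Slicing by complex lines gives connectedness of \<open>V - A\<close>; if
  \<open>V\<close> meets the interior of \<open>A\<close>, the identity theorem makes every equation
  vanish on all of \<open>V\<close>.\<close>

lemma analytic_subset_good_neighbourhood: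
  assumes atlas: "complex_atlas n \<A>" and A: "analytic_subset n \<A> UNIV A"
    and O: "open S" "x \<in> S"
  obtains V where "open V" "x \<in> V" "V \<subseteq> S" "connected (V - A)"
    "V \<inter> interior A \<noteq> {} \<Longrightarrow> V \<subseteq> A"
proof -
  obtain W fs where W: "open W" "x \<in> W" "W \<subseteq> UNIV" "finite fs"
      "\<forall>f\<in>fs. holomorphic_fun n \<A> W f" "A \<inter> W = {q \<in> W. \<forall>f\<in>fs. f q = 0}"
    by (rule analytic_subset_local_equations[OF A UNIV_I[of x]])
  obtain U \<phi> where U: "(U, \<phi>) \<in> \<A>" "x \<in> U" "complex_chart n (U, \<phi>)"
    using atlas_chart_at[OF atlas] .
  note c = complex_chart_inv[OF U(3)]
  define \<psi> where "\<psi> = inv_into U \<phi>"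
  have \<psi>\<phi>: "\<psi> (\<phi> y) = y" if "y \<in> U" for y using that c(2) by (simp add: \<psi>_def)
  have "openin (top_of_set (Cn n)) (\<phi> ` (U \<inter> W \<inter> S))"
    using c(1) W(1) O(1) by (intro c(5)) auto
  moreover have "\<phi> x \<in> \<phi> ` (U \<inter> W \<inter> S)" using U W O by blast
  ultimately obtain e where e: "e > 0" "polydisc n (\<phi> x) e \<subseteq> \<phi> ` (U \<inter> W \<inter> S)"
    by (rule openin_Cn_contains_polydisc)
  define P where "P = polydisc n (\<phi> x) e"
  define V where "V = U \<inter> \<phi> -` P"
  have P: "P \<subseteq> \<phi> ` (U \<inter> W \<inter> S)" using e by (simp add: P_def)
  have VP: "V = \<psi> ` P" "\<phi> ` V = P"
  proof -
    have *: "\<psi> w \<in> U \<and> \<phi> (\<psi> w) = w" if "w \<in> P" for w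
      using that P \<psi>\<phi> by fastforce
    show "V = \<psi> ` P"
    proof (intro equalityI subsetI)
      fix y assume "y \<in> V"
      then have "\<phi> y \<in> P" "y = \<psi> (\<phi> y)" using \<psi>\<phi> by (auto simp: V_def)
      then show "y \<in> \<psi> ` P" by blast
    qed (use * in \<open>auto simp: V_def\<close>)
    then show "\<phi> ` V = P" using * by (simp add: image_image)
  qed
  have V: "open V"
  proof -
    have "openin (top_of_set (\<phi> ` U)) P"
    proof (rule openin_subset_trans)
      show "openin (top_of_set (Cn n)) P" unfolding P_def by (rule openin_polydisc)
    qed (use P c(3) in auto)
    then have "openin (top_of_set U) (U \<inter> \<phi> -` P)"
      using c(4) by (intro continuous_openin_preimage[where T="\<phi> ` U"]) (auto simp: homeomorphism_def)
    then show ?thesis unfolding V_def using c(1) openin_open_eq by blast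
  qed
  have VS: "V \<subseteq> U \<inter> W \<inter> S"
    using P \<psi>\<phi> unfolding VP(1) by auto
  have xV: "x \<in> V" using U(2) c(3) e(1) by (auto simp: V_def P_def polydisc_def)
  have hol: "holo_on n P (f \<circ> \<psi>)" if "f \<in> fs" for f
  proof (rule holo_on_subset)
    show "holo_on n (\<phi> ` (U \<inter> W)) (f \<circ> \<psi>)"
      using bspec[OF W(5) that] U(1) unfolding \<psi>_def holomorphic_fun_def by blast
  qed (use P in auto)
  have "connected {w \<in> P. \<exists>g\<in>(\<lambda>f. f \<circ> \<psi>) ` fs. g w \<noteq> 0}"
    unfolding P_def by (intro connected_polydisc_minus_zeros) (use hol P_def in auto)
  moreover have "continuous_on P \<psi>"
  proof (rule continuous_on_subset)
    show "continuous_on (\<phi> ` U) \<psi>" using c(4) by (simp add: \<psi>_def homeomorphism_def)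
  qed (use P in auto)
  ultimately have "connected (\<psi> ` {w \<in> P. \<exists>g\<in>(\<lambda>f. f \<circ> \<psi>) ` fs. g w \<noteq> 0})"
    by (rule connected_continuous_image[OF continuous_on_subset, rotated 2]) auto
  moreover have "\<psi> ` {w \<in> P. \<exists>g\<in>(\<lambda>f. f \<circ> \<psi>) ` fs. g w \<noteq> 0} = V - A"
  proof -
    have "\<psi> w \<in> A \<longleftrightarrow> (\<forall>f\<in>fs. f (\<psi> w) = 0)" if "w \<in> P" for w
      using that W(6) VS unfolding VP(1) by blast
    then show ?thesis unfolding VP(1) by auto
  qed
  ultimately have conn: "connected (V - A)" by simp
  have "V \<subseteq> A" if ne: "V \<inter> interior A \<noteq> {}"
  proof -
    define N where "N = \<phi> ` (V \<inter> interior A)"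
    have N: "openin (top_of_set (Cn n)) N" "N \<subseteq> P" "N \<noteq> {}"
      unfolding N_def using V VS VP(2) ne by (auto intro!: c(5))
    have zero: "(f \<circ> \<psi>) w = 0" if f: "f \<in> fs" and w: "w \<in> N" for f w
    proof -
      obtain y where y: "y \<in> V" "y \<in> interior A" "w = \<phi> y" using w by (auto simp: N_def)
      then have "y \<in> A \<inter> W" using VS interior_subset by blast
      then show ?thesis using W(6) f y VS \<psi>\<phi> by auto
    qed
    have "(f \<circ> \<psi>) w = 0" if "f \<in> fs" "w \<in> P" for f w
      using polydisc_identity[of n "\<phi> x" e "f \<circ> \<psi>" N w] hol[OF that(1)] N zero[OF that(1)] that(2)
      unfolding P_def by blast
    then have "f y = 0" if "f \<in> fs" "y \<in> V" for f y
      using that unfolding VP(1) by auto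
    then show ?thesis using W(6) VS by blast
  qed
  with that V xV VS conn show ?thesis by blast
qed

text \<open>The interior is closed as well as open: if a good neighbourhood of a point meets it,
  that neighbourhood lies in \<open>A\<close>, hence in the interior. Connectedness of the manifold
  then decides.\<close>

lemma interior_proper_analytic_subset:
  assumes "complex_manifold n \<A>" "analytic_subset n \<A> UNIV A" "A \<noteq> UNIV"
  shows "interior A = {}"
proof -
  have atlas: "complex_atlas n \<A>" and conn: "connected (UNIV :: 'a set)"
    using assms(1) by (auto simp: complex_manifold_def)
  have "open (- interior A)"
  proof (subst open_subopen, rule ballI)
    fix x assume x: "x \<in> - interior A"
    obtain V where V: "open V" "x \<in> V" "V \<inter> interior A \<noteq> {} \<Longrightarrow> V \<subseteq> A"
      using analytic_subset_good_neighbourhood[OF atlas assms(2) open_UNIV UNIV_I] by metis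
    have "V \<inter> interior A = {}"
    proof (rule ccontr)
      assume "V \<inter> interior A \<noteq> {}"
      then have "V \<subseteq> interior A" using V by (simp add: interior_maximal)
      then show False using V x by blast
    qed
    then show "\<exists>T. open T \<and> x \<in> T \<and> T \<subseteq> - interior A" using V by blast
  qed
  then have "closed (interior A)" by (simp add: closed_def)
  then have "interior A = {} \<or> interior A = UNIV"
    using conn open_interior unfolding connected_clopen by force
  then show ?thesis using assms(3) interior_subset by blast
qed


section \<open>Local degrees and fibre sums\<close>

lemma finite_separation:
  fixes S :: "'a::t2_space set"
  assumes "finite S" and W: "\<And>q. q \<in> S \<Longrightarrow> open (W q) \<and> q \<in> W q"
  obtains U where "\<And>q. q \<in> S \<Longrightarrow> open (U q) \<and> q \<in> U q \<and> U q \<subseteq> W q"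
    "\<And>p q. p \<in> S \<Longrightarrow> q \<in> S \<Longrightarrow> p \<noteq> q \<Longrightarrow> U p \<inter> U q = {}"
proof -
  have "\<exists>A B. open A \<and> open B \<and> p \<in> A \<and> q \<in> B \<and> A \<inter> B = {}" if "p \<noteq> q" for p q :: 'a
    using hausdorff[OF that] by blast
  then obtain A B where AB: "\<And>p q :: 'a. p \<noteq> q \<Longrightarrow>
      open (A p q) \<and> open (B p q) \<and> p \<in> A p q \<and> q \<in> B p q \<and> A p q \<inter> B p q = {}"
    by metis
  \<comment> \<open>For each other point \<open>p\<close>, \<open>q\<close> receives its side of
    both chosen separations, of \<open>(q, p)\<close> and of \<open>(p, q)\<close>; for any pair the
    disjoint sets \<open>A p q\<close> and \<open>B p q\<close> are then both in force.\<close>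
  define U where "U q = W q \<inter> (\<Inter>p\<in>S - {q}. A q p \<inter> B p q)" for q
  show ?thesis
  proof (rule that)
    fix q assume q: "q \<in> S"
    have "open (\<Inter>p\<in>S - {q}. A q p \<inter> B p q)"
      using assms(1) AB by (intro open_INT) auto
    moreover have "q \<in> A q p \<inter> B p q" if "p \<in> S - {q}" for p
      using AB[of q p] AB[of p q] that by auto
    then have "q \<in> (\<Inter>p\<in>S - {q}. A q p \<inter> B p q)" by blast
    ultimately show "open (U q) \<and> q \<in> U q \<and> U q \<subseteq> W q" using W[OF q] by (auto simp: U_def)
  next
    fix p q assume pq: "p \<in> S" "q \<in> S" "p \<noteq> q"
    then have "U p \<subseteq> A p q" "U q \<subseteq> B p q" by (auto simp: U_def)
    then show "U p \<inter> U q = {}" using AB[OF pq(3)] by blast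
  qed
qed

text \<open>One half of uniqueness, the other following by symmetry. The neighbourhood
  \<open>W'\<close> is requested inside \<open>W\<close>, so the counts over a point generic for
  both are comparable.\<close>

lemma has_local_degree_le:
  assumes atlas: "complex_atlas k \<A>"
    and n: "has_local_degree k \<A> G p n" and m: "has_local_degree k \<A> G p m"
  shows "m \<le> n"
proof -
  obtain W V Z where W: "open W" "p \<in> W" and V: "open V" "snd p \<in> V" "analytic_subset k \<A> V Z"
      "interior Z = {}"
      "\<forall>x \<in> V - Z. finite {q \<in> G \<inter> W. snd q = x} \<and> card {q \<in> G \<inter> W. snd q = x} = n"
    using n[unfolded has_local_degree_def, rule_format, of UNIV] by auto
  obtain W' V' Z' where W': "W' \<subseteq> W" and V': "open V'" "snd p \<in> V'" "analytic_subset k \<A> V' Z'"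
      "interior Z' = {}"
      "\<forall>x \<in> V' - Z'. finite {q \<in> G \<inter> W'. snd q = x} \<and> card {q \<in> G \<inter> W'. snd q = x} = m"
    using m[unfolded has_local_degree_def, rule_format, of W] W by blast
  \<comment> \<open>Two sets with empty interior could together fill an open set. Closedness of
    \<open>Z\<close> in \<open>V\<close> rules this out and yields a common generic point.\<close>
  have op: "open (V - Z)" using open_Diff_analytic_subset[OF atlas V(3)] .
  have "\<not> V \<inter> V' \<subseteq> Z"
    using V V' interior_maximal[of "V \<inter> V'" Z] by auto
  then have "\<not> (V - Z) \<inter> V' \<subseteq> Z'"
    using op V' interior_maximal[of "(V - Z) \<inter> V'" Z'] by auto
  then obtain x where x: "x \<in> V - Z" "x \<in> V' - Z'" by blast
  have "m = card {q \<in> G \<inter> W'. snd q = x}" using bspec[OF V'(5) x(2)] by simp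
  also have "\<dots> \<le> card {q \<in> G \<inter> W. snd q = x}"
    using bspec[OF V(5) x(1)] W' by (intro card_mono) auto
  also have "\<dots> = n" using bspec[OF V(5) x(1)] by simp
  finally show ?thesis .
qed

lemma local_degree_eqI:
  assumes "complex_atlas k \<A>" "has_local_degree k \<A> G p n"
  shows "local_degree k \<A> G p = n"
  unfolding local_degree_def
proof (rule the_equality)
  show "m = n" if "has_local_degree k \<A> G p m" for m
    using has_local_degree_le[OF assms(1) that assms(2)] has_local_degree_le[OF assms that] by simp
qed fact

text \<open>The setting for counting on one component of the chain. Properness of the projection
  appears as compactness of \<open>G\<close>, to which it leads because the base is compact.\<close>

locale branched_component =
  fixes k :: nat and \<A> :: "'x::{t2_space,second_countable_topology} chart set"
    and G :: "('x \<times> 'x) set" and \<Omega> :: "'x set" and \<delta> :: nat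
  assumes manifold: "complex_manifold k \<A>"
    and compact_G: "compact G"
    and finite_fibres: "finite {p \<in> G. snd p = x}"
    and nonempty: "\<Omega> \<noteq> {}"
    and zariski: "zariski_open k \<A> \<Omega>"
    and covering: "holomorphic_covering k \<A> G \<Omega> \<delta>"
begin

abbreviation fib :: "('x \<times> 'x) set \<Rightarrow> 'x \<Rightarrow> ('x \<times> 'x) set" where
  "fib W x \<equiv> {q \<in> G \<inter> W. snd q = x}"

abbreviation ldeg :: "'x \<times> 'x \<Rightarrow> nat" where
  "ldeg \<equiv> local_degree k \<A> G"

lemma atlas: "complex_atlas k \<A>"
  using manifold by (simp add: complex_manifold_def)

lemma analytic: "analytic_subset k \<A> UNIV (- \<Omega>)"
  using zariski by (simp add: zariski_open_def)

lemma interior_compl: "interior (- \<Omega>) = {}"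
  using interior_proper_analytic_subset[OF manifold analytic] nonempty by auto

lemma finite_fib: "finite (fib W x)"
  by (rule finite_subset[OF _ finite_fibres[of x]]) auto

lemma card_fib_UNIV: "x \<in> \<Omega> \<Longrightarrow> card (fib UNIV x) = \<delta>"
  using covering by (simp add: holomorphic_covering_def)

section \<open>Fibre counts near points of the base\<close>

lemma eventually_dense:
  assumes "eventually P (nhds x)"
  obtains y where "y \<in> \<Omega>" "P y"
proof -
  obtain S where S: "open S" "x \<in> S" "\<And>y. y \<in> S \<Longrightarrow> P y" using assms by (auto simp: eventually_nhds)
  have "\<not> S \<subseteq> - \<Omega>" using S interior_maximal[of S "- \<Omega>"] interior_compl by blast
  then show ?thesis using S that by blast
qed

lemma local_section:
  assumes "q \<in> G" "snd q \<in> \<Omega>"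
  obtains W s where "open W" "q \<in> W" "s (snd q) = fst q" "(s \<longlongrightarrow> fst q) (nhds (snd q))"
    "\<forall>\<^sub>F x in nhds (snd q). fib W x = {(s x, x)}"
proof -
  obtain W T s where W: "open W" "q \<in> W" "open T" "holomorphic_map k \<A> k \<A> T s"
      "G \<inter> W = {(s x, x) | x. x \<in> T}"
  proof -
    have "q \<in> G \<inter> snd -` \<Omega>" using assms by simp
    with covering[unfolded holomorphic_covering_def, THEN conjunct2, THEN conjunct2]
    have "\<exists>W T s. open W \<and> q \<in> W \<and> open T \<and> T \<subseteq> \<Omega> \<and> holomorphic_map k \<A> k \<A> T s \<and>
        G \<inter> W = {(s x, x) | x. x \<in> T}" by (rule bspec)
    then show ?thesis by (elim exE conjE) (rule that)
  qed
  have "q \<in> {(s x, x) | x. x \<in> T}" using W(2,5) assms(1) by blast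
  then have q: "snd q \<in> T" "s (snd q) = fst q" by auto
  have "continuous_on T s" using W(4) by (simp add: holomorphic_map_def)
  then have "(s \<longlongrightarrow> s (snd q)) (at (snd q))"
    using q(1) at_within_open[OF q(1) W(3)] unfolding continuous_on_def by force
  then have lim: "(s \<longlongrightarrow> fst q) (nhds (snd q))"
    using q(2) tendsto_at_iff_tendsto_nhds[of s "snd q"] by simp
  have "\<forall>\<^sub>F x in nhds (snd q). fib W x = {(s x, x)}"
  proof -
    have "fib W x = {(s x, x)}" if "x \<in> T" for x
      unfolding W(5) using that by auto
    then show ?thesis using W(3) q(1) unfolding eventually_nhds by blast
  qed
  then show ?thesis by (rule that[OF W(1,2) q(2) lim])
qed

text \<open>Each point of \<open>fib W x\<close> continues along its local section. For
  \<open>y\<close> near \<open>x\<close> the finitely many continuations stay in \<open>W\<close>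
  and remain distinct, so \<open>fib W x\<close> injects into \<open>fib W y\<close>.\<close>

lemma card_fib_lower_semicontinuous:
  assumes "open W" "x \<in> \<Omega>"
  shows "\<forall>\<^sub>F y in nhds x. card (fib W x) \<le> card (fib W y)"
proof -
  have "\<forall>q\<in>fib W x. \<exists>s. s x = fst q \<and> (s \<longlongrightarrow> fst q) (nhds x) \<and>
      (\<forall>\<^sub>F y in nhds x. (s y, y) \<in> G)"
  proof
    fix q assume q: "q \<in> fib W x"
    have "q \<in> G" "snd q \<in> \<Omega>" "snd q = x" using q assms(2) by auto
    then obtain W' s where s: "open W'" "q \<in> W'" "s x = fst q" "(s \<longlongrightarrow> fst q) (nhds x)"
        "\<forall>\<^sub>F y in nhds x. fib W' y = {(s y, y)}"
      using local_section[of q] by blast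
    from s(5) have "\<forall>\<^sub>F y in nhds x. (s y, y) \<in> G"
      by eventually_elim blast
    then show "\<exists>s. s x = fst q \<and> (s \<longlongrightarrow> fst q) (nhds x) \<and> (\<forall>\<^sub>F y in nhds x. (s y, y) \<in> G)"
      using s(3,4) by blast
  qed
  then obtain s where "\<forall>q\<in>fib W x. s q x = fst q \<and> (s q \<longlongrightarrow> fst q) (nhds x) \<and>
      (\<forall>\<^sub>F y in nhds x. (s q y, y) \<in> G)"
    by (rule bchoice[THEN exE])
  then have s: "s q x = fst q" "(s q \<longlongrightarrow> fst q) (nhds x)" "\<forall>\<^sub>F y in nhds x. (s q y, y) \<in> G"
    if "q \<in> fib W x" for q
    using that by blast+
  have "\<forall>\<^sub>F y in nhds x. \<forall>q\<in>fib W x. (s q y, y) \<in> G \<inter> W"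
  proof (intro eventually_ball_finite ballI finite_fib)
    fix q assume q: "q \<in> fib W x"
    have "((\<lambda>y. (s q y, y)) \<longlongrightarrow> (fst q, x)) (nhds x)"
      using s(2)[OF q] by (intro tendsto_Pair filterlim_ident)
    moreover have "(fst q, x) \<in> W" using q by auto
    ultimately have "\<forall>\<^sub>F y in nhds x. (s q y, y) \<in> W"
      using assms(1) topological_tendstoD by blast
    moreover have "\<forall>\<^sub>F y in nhds x. (s q y, y) \<in> G" by (rule s(3)[OF q])
    ultimately show "\<forall>\<^sub>F y in nhds x. (s q y, y) \<in> G \<inter> W"
      by eventually_elim blast
  qed
  moreover have "\<forall>\<^sub>F y in nhds x. \<forall>q\<in>fib W x. \<forall>q'\<in>fib W x. q \<noteq> q' \<longrightarrow> s q y \<noteq> s q' y"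
  proof (intro eventually_ball_finite ballI finite_fib)
    fix q q' assume q: "q \<in> fib W x" "q' \<in> fib W x"
    show "\<forall>\<^sub>F y in nhds x. q \<noteq> q' \<longrightarrow> s q y \<noteq> s q' y"
    proof (cases "q = q'")
      case False
      then have "fst q \<noteq> fst q'" using q by (auto simp: prod_eq_iff)
      then obtain A B where AB: "open A" "open B" "fst q \<in> A" "fst q' \<in> B" "A \<inter> B = {}"
        using hausdorff[of "fst q" "fst q'"] by blast
      have "\<forall>\<^sub>F y in nhds x. s q y \<in> A" "\<forall>\<^sub>F y in nhds x. s q' y \<in> B"
        using AB topological_tendstoD[OF s(2)[OF q(1)]] topological_tendstoD[OF s(2)[OF q(2)]]
        by blast+
      then show ?thesis by eventually_elim (use AB in auto)
    qed simp
  qed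
  ultimately show ?thesis
  proof eventually_elim
    case (elim y)
    have "inj_on (\<lambda>q. (s q y, y)) (fib W x)"
    proof (rule inj_onI)
      fix q q' assume "q \<in> fib W x" "q' \<in> fib W x" "(s q y, y) = (s q' y, y)"
      then show "q = q'" using elim(2) by blast
    qed
    moreover have "(\<lambda>q. (s q y, y)) ` fib W x \<subseteq> fib W y" using elim(1) by auto
    ultimately show ?case by (rule card_inj_on_le[OF _ _ finite_fib])
  qed
qed

lemma card_fib_Un:
  assumes "W \<inter> W' = {}" "fib UNIV x \<subseteq> W \<union> W'" "x \<in> \<Omega>"
  shows "card (fib W x) + card (fib W' x) = \<delta>"
proof -
  have "card (fib W x \<union> fib W' x) = card (fib W x) + card (fib W' x)"
    by (rule card_Un_disjoint) (use assms(1) finite_fib in auto)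
  moreover have "fib W x \<union> fib W' x = fib UNIV x" using assms(2) by auto
  ultimately show ?thesis using card_fib_UNIV[OF assms(3)] by simp
qed

text \<open>
  Off the branch locus both counts are lower semicontinuous with constant sum, hence locally
  constant, and \<open>V \<inter> \<Omega>\<close> is connected for suitable small neighbourhoods \<open>V\<close>.
\<close>

lemma card_fib_constant:
  assumes W: "open W" "open W'" "W \<inter> W' = {}"
    and ev: "\<forall>\<^sub>F y in nhds x. fib UNIV y \<subseteq> W \<union> W'"
  obtains n where "\<forall>\<^sub>F y in nhds x. y \<in> \<Omega> \<longrightarrow> card (fib W y) = n"
proof -
  obtain S where S: "open S" "x \<in> S" "\<And>y. y \<in> S \<Longrightarrow> fib UNIV y \<subseteq> W \<union> W'"
    using ev unfolding eventually_nhds by blast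
  obtain V where V: "open V" "x \<in> V" "V \<subseteq> S" "connected (V - (- \<Omega>))"
    using analytic_subset_good_neighbourhood[OF atlas analytic S(1,2)] by metis
  define A where "A = V - (- \<Omega>)"
  have A: "y \<in> V" "y \<in> \<Omega>" if "y \<in> A" for y using that by (auto simp: A_def)
  have loc: "\<forall>a\<in>A. \<forall>\<^sub>F b in at a within A. card (fib W a) = card (fib W b)"
  proof
    fix a assume a: "a \<in> A"
    have "\<forall>\<^sub>F b in nhds a. b \<noteq> a \<longrightarrow> b \<in> A \<longrightarrow> card (fib W a) = card (fib W b)"
      using card_fib_lower_semicontinuous[OF W(1) A(2)[OF a]]
        card_fib_lower_semicontinuous[OF W(2) A(2)[OF a]]
    proof eventually_elim
      case (elim b)
      show ?case
      proof (intro impI)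
        assume b: "b \<in> A"
        have "card (fib W b) + card (fib W' b) = \<delta>" "card (fib W a) + card (fib W' a) = \<delta>"
          using a b A S(3) V(3) by (intro card_fib_Un W(3); blast)+
        then show "card (fib W a) = card (fib W b)" using elim by linarith
      qed
    qed
    then show "\<forall>\<^sub>F b in at a within A. card (fib W a) = card (fib W b)"
      by (simp add: eventually_at_filter)
  qed
  obtain a where a: "a \<in> \<Omega>" "a \<in> V"
    using eventually_dense[of "\<lambda>y. y \<in> V" x] V eventually_nhds by blast
  have "card (fib W y) = card (fib W a)" if "y \<in> V" "y \<in> \<Omega>" for y
    using connected_local_const[of A y a "\<lambda>y. card (fib W y)"] V(4) loc a that
    unfolding A_def by blast
  then show ?thesis using that[of "card (fib W a)"] V eventually_nhds by blast
qed

text \<open>The part of \<open>G\<close> outside \<open>W\<close> is compact, so its projection is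
  closed, and it misses \<open>x\<close>.\<close>

lemma fib_upper_semicontinuous:
  assumes "open W" "fib UNIV x \<subseteq> W"
  shows "\<forall>\<^sub>F y in nhds x. fib UNIV y \<subseteq> W"
proof -
  have "compact (G \<inter> - W)" using compact_G assms(1) by (intro compact_Int_closed) (auto simp: closed_def)
  then have "compact (snd ` (G \<inter> - W))" by (intro compact_continuous_image continuous_on_snd continuous_on_id)
  then have "open (- snd ` (G \<inter> - W))" by (simp add: compact_imp_closed open_Compl)
  moreover have "x \<in> - snd ` (G \<inter> - W)" using assms(2) by auto
  moreover have "fib UNIV y \<subseteq> W" if "y \<in> - snd ` (G \<inter> - W)" for y using that by auto
  ultimately show ?thesis unfolding eventually_nhds by blast
qed

text \<open>The witness \<open>W'\<close> expresses that the other points of the fibre lie off the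
  closure of \<open>W\<close>, in the form in which \<open>W\<close> and \<open>W'\<close> together
  catch all nearby fibres.\<close>

definition isolates :: "('x \<times> 'x) set \<Rightarrow> 'x \<times> 'x \<Rightarrow> bool" where
  "isolates W p \<longleftrightarrow> open W \<and> p \<in> W \<and>
     (\<exists>W'. open W' \<and> W \<inter> W' = {} \<and> fib UNIV (snd p) - {p} \<subseteq> W')"

lemma isolates_Int: "isolates W p \<Longrightarrow> open S \<Longrightarrow> p \<in> S \<Longrightarrow> isolates (W \<inter> S) p"
  unfolding isolates_def
proof (elim conjE exE, intro conjI)
  fix W' assume "open W'" "W \<inter> W' = {}" "fib UNIV (snd p) - {p} \<subseteq> W'"
  then show "\<exists>W'. open W' \<and> W \<inter> S \<inter> W' = {} \<and> fib UNIV (snd p) - {p} \<subseteq> W'"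
    by (intro exI[of _ W']) auto
qed auto

lemma isolating_family:
  assumes "\<And>q. q \<in> fib UNIV x \<Longrightarrow> open (S q) \<and> q \<in> S q"
  obtains W where "\<And>q. q \<in> fib UNIV x \<Longrightarrow> isolates (W q) q \<and> W q \<subseteq> S q"
    "\<And>p q. p \<in> fib UNIV x \<Longrightarrow> q \<in> fib UNIV x \<Longrightarrow> p \<noteq> q \<Longrightarrow> W p \<inter> W q = {}"
proof -
  obtain W where W: "\<And>q. q \<in> fib UNIV x \<Longrightarrow> open (W q) \<and> q \<in> W q \<and> W q \<subseteq> S q"
    "\<And>p q. p \<in> fib UNIV x \<Longrightarrow> q \<in> fib UNIV x \<Longrightarrow> p \<noteq> q \<Longrightarrow> W p \<inter> W q = {}"
    using finite_separation[OF finite_fib[of UNIV x] assms] by blast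
  have "isolates (W q) q" if q: "q \<in> fib UNIV x" for q
    unfolding isolates_def
  \<comment> \<open>The other members of the disjoint family serve as the second open set.\<close>
  proof (intro conjI exI[of _ "\<Union>p\<in>fib UNIV x - {q}. W p"])
    have "snd q = x" using q by simp
    then show "fib UNIV (snd q) - {q} \<subseteq> (\<Union>p\<in>fib UNIV x - {q}. W p)" using W(1) by auto
    show "W q \<inter> (\<Union>p\<in>fib UNIV x - {q}. W p) = {}" using W(2)[OF q] by blast
  qed (use W(1) q in auto)
  then show ?thesis using that W by blast
qed

lemma isolating_exists:
  assumes "p \<in> G"
  obtains W where "isolates W p"
proof -
  obtain W where "\<And>q. q \<in> fib UNIV (snd p) \<Longrightarrow> isolates (W q) q \<and> W q \<subseteq> UNIV"
    by (rule isolating_family[of "snd p" "\<lambda>_. UNIV"]) auto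
  then show ?thesis using that assms by blast
qed

lemma isolates_card_constant:
  assumes "isolates W p"
  obtains n where "\<forall>\<^sub>F y in nhds (snd p). y \<in> \<Omega> \<longrightarrow> card (fib W y) = n"
proof -
  obtain W' where W': "open W" "p \<in> W" "open W'" "W \<inter> W' = {}" "fib UNIV (snd p) - {p} \<subseteq> W'"
    using assms by (auto simp: isolates_def)
  have "\<forall>\<^sub>F y in nhds (snd p). fib UNIV y \<subseteq> W \<union> W'"
    using W' by (intro fib_upper_semicontinuous) auto
  from card_fib_constant[OF W'(1,3,4) this] show ?thesis using that by blast
qed

text \<open>Nearby fibres lie in \<open>W \<inter> S\<close> or in \<open>W'\<close>, and
  \<open>W'\<close> is disjoint from \<open>W\<close>; so their points in \<open>W\<close> are
  already in \<open>S\<close>. This is why one isolating neighbourhood determines the counts in all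
  smaller ones.\<close>

lemma isolates_Int_fib_eq:
  assumes W: "isolates W p" and S: "open S" "p \<in> S"
  shows "\<forall>\<^sub>F y in nhds (snd p). fib (W \<inter> S) y = fib W y"
proof -
  obtain W' where W': "open W" "p \<in> W" "open W'" "W \<inter> W' = {}" "fib UNIV (snd p) - {p} \<subseteq> W'"
    using W by (auto simp: isolates_def)
  have "\<forall>\<^sub>F y in nhds (snd p). fib UNIV y \<subseteq> W \<inter> S \<union> W'"
    using W' S by (intro fib_upper_semicontinuous) auto
  then show ?thesis by eventually_elim (use W'(4) in auto)
qed

lemma has_local_degreeI:
  assumes W: "isolates W p" and n: "\<forall>\<^sub>F y in nhds (snd p). y \<in> \<Omega> \<longrightarrow> card (fib W y) = n"
  shows "has_local_degree k \<A> G p n"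
  unfolding has_local_degree_def
proof (intro allI impI)
  fix S assume S: "open S \<and> p \<in> S"
  have "\<forall>\<^sub>F y in nhds (snd p). y \<in> \<Omega> \<longrightarrow> card (fib (W \<inter> S) y) = n"
    using n isolates_Int_fib_eq[OF W conjunct1[OF S] conjunct2[OF S]] by eventually_elim simp
  then obtain V where V: "open V" "snd p \<in> V" "\<And>y. y \<in> V \<Longrightarrow> y \<in> \<Omega> \<Longrightarrow> card (fib (W \<inter> S) y) = n"
    unfolding eventually_nhds by blast
  show "\<exists>W V Z. open W \<and> p \<in> W \<and> W \<subseteq> S \<and> open V \<and> snd p \<in> V \<and>
      analytic_subset k \<A> V Z \<and> interior Z = {} \<and>
      (\<forall>x\<in>V - Z. finite {q \<in> G \<inter> W. snd q = x} \<and> card {q \<in> G \<inter> W. snd q = x} = n)"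
  \<comment> \<open>The exceptional set for the local degree is the trace on \<open>V\<close> of the
    complement of the covering locus.\<close>
  proof (rule exI[of _ "W \<inter> S"], rule exI[of _ V], rule exI[of _ "- \<Omega> \<inter> V"], intro conjI ballI)
    show "analytic_subset k \<A> V (- \<Omega> \<inter> V)"
      using analytic_subset_restrict[OF analytic V(1)] by simp
    show "interior (- \<Omega> \<inter> V) = {}"
      using interior_mono[of "- \<Omega> \<inter> V" "- \<Omega>"] interior_compl by auto
    fix y assume "y \<in> V - (- \<Omega> \<inter> V)"
    then show "card (fib (W \<inter> S) y) = n" using V(3) by blast
    show "finite (fib (W \<inter> S) y)" by (rule finite_fib)
  qed (use V S W in \<open>auto simp: isolates_def\<close>)
qed

lemma isolates_card_eq_local_degree:
  assumes "isolates W p"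
  shows "\<forall>\<^sub>F y in nhds (snd p). y \<in> \<Omega> \<longrightarrow> card (fib W y) = ldeg p"
proof -
  obtain n where n: "\<forall>\<^sub>F y in nhds (snd p). y \<in> \<Omega> \<longrightarrow> card (fib W y) = n"
    using isolates_card_constant[OF assms] .
  then have "ldeg p = n" using local_degree_eqI[OF atlas has_local_degreeI[OF assms n]] by simp
  then show ?thesis using n by simp
qed

lemma local_degree_unbranched:
  assumes "q \<in> G" "snd q \<in> \<Omega>"
  shows "ldeg q = 1"
proof -
  obtain S s where s: "open S" "q \<in> S" "s (snd q) = fst q" "(s \<longlongrightarrow> fst q) (nhds (snd q))"
    "\<forall>\<^sub>F x in nhds (snd q). fib S x = {(s x, x)}"
    by (rule local_section[OF assms])
  obtain W where W: "isolates W q" using isolating_exists[OF assms(1)] .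
  have WS: "isolates (S \<inter> W) q"
    using isolates_Int[OF W s(1,2)] by (simp add: Int_commute)
  have "((\<lambda>x. (s x, x)) \<longlongrightarrow> (fst q, snd q)) (nhds (snd q))"
    using s(4) by (intro tendsto_Pair filterlim_ident)
  then have "\<forall>\<^sub>F x in nhds (snd q). (s x, x) \<in> W"
    using W topological_tendstoD unfolding isolates_def prod.collapse by blast
  with s(5) have "\<forall>\<^sub>F x in nhds (snd q). x \<in> \<Omega> \<longrightarrow> card (fib (S \<inter> W) x) = 1"
  proof eventually_elim
    case (elim x)
    then have "fib (S \<inter> W) x = {(s x, x)}" by auto
    then show ?case by simp
  qed
  then show ?thesis using local_degree_eqI[OF atlas has_local_degreeI[OF WS]] by simp
qed

text \<open>\<open>adjoint_mult\<close> adds local degrees over all components, including those that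
  miss the point, and a definite description has no default value. Since \<open>G\<close> is closed,
  \<open>S - G\<close> is a neighbourhood containing no point of \<open>G\<close>.\<close>

lemma local_degree_outside:
  assumes "p \<notin> G"
  shows "ldeg p = 0"
proof (rule local_degree_eqI[OF atlas])
  have "closed G" using compact_G by (rule compact_imp_closed)
  show "has_local_degree k \<A> G p 0"
    unfolding has_local_degree_def
  proof (intro allI impI)
    fix S assume S: "open S \<and> p \<in> S"
    have e: "{q \<in> G \<inter> (S - G). snd q = x} = {}" for x by auto
    show "\<exists>W V Z. open W \<and> p \<in> W \<and> W \<subseteq> S \<and> open V \<and> snd p \<in> V \<and>
        analytic_subset k \<A> V Z \<and> interior Z = {} \<and>
        (\<forall>x\<in>V - Z. finite {q \<in> G \<inter> W. snd q = x} \<and> card {q \<in> G \<inter> W. snd q = x} = 0)"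
      by (rule exI[of _ "S - G"], rule exI[of _ UNIV], rule exI[of _ "{}"])
        (use S \<open>closed G\<close> assms in \<open>auto simp: e analytic_subset_empty open_Diff\<close>)
  qed
qed

section \<open>Continuity of fibre sums\<close>

definition fibre_sum :: "('x \<times> 'x \<Rightarrow> real) \<Rightarrow> 'x \<Rightarrow> real" where
  "fibre_sum \<phi> x = (\<Sum>q\<in>fib UNIV x. real (ldeg q) * \<phi> q)"

lemma fibre_sum_unbranched: "x \<in> \<Omega> \<Longrightarrow> fibre_sum \<phi> x = (\<Sum>q\<in>fib UNIV x. \<phi> q)"
  unfolding fibre_sum_def by (rule sum.cong[OF refl]) (simp add: local_degree_unbranched)

text \<open>Over a generic \<open>y\<close> near \<open>x\<close>, each \<open>p\<close> in the
  fibre of \<open>x\<close> is replaced by \<open>ldeg p\<close> points of \<open>W p\<close>, where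
  \<open>\<phi>\<close> differs from \<open>\<phi> p\<close> by less than \<open>e\<close>. There
  are \<open>\<delta>\<close> points in total.\<close>

lemma fibre_sum_limit:
  assumes \<phi>: "continuous_on UNIV \<phi>" and e: "e > 0"
  shows "\<forall>\<^sub>F y in nhds x. y \<in> \<Omega> \<longrightarrow> \<bar>fibre_sum \<phi> y - fibre_sum \<phi> x\<bar> \<le> e * real \<delta>"
proof -
  define F where "F = fib UNIV x"
  define S where "S q = {p. \<bar>\<phi> p - \<phi> q\<bar> < e}" for q
  have S: "open (S q) \<and> q \<in> S q" for q
    unfolding S_def using e by (auto intro!: open_Collect_less continuous_intros \<phi>)
  obtain W where W: "\<And>q. q \<in> F \<Longrightarrow> isolates (W q) q \<and> W q \<subseteq> S q"
    "\<And>p q. p \<in> F \<Longrightarrow> q \<in> F \<Longrightarrow> p \<noteq> q \<Longrightarrow> W p \<inter> W q = {}"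
    unfolding F_def by (rule isolating_family[of x S]) (use S in blast)+
  have "\<forall>\<^sub>F y in nhds x. fib UNIV y \<subseteq> (\<Union>q\<in>F. W q)"
    using W(1) by (intro fib_upper_semicontinuous) (auto simp: isolates_def F_def)
  moreover have "\<forall>\<^sub>F y in nhds x. \<forall>q\<in>F. y \<in> \<Omega> \<longrightarrow> card (fib (W q) y) = ldeg q"
  proof (intro eventually_ball_finite ballI)
    show "finite F" by (simp only: F_def finite_fib)
    fix q assume q: "q \<in> F"
    then have "snd q = x" by (simp add: F_def)
    then show "\<forall>\<^sub>F y in nhds x. y \<in> \<Omega> \<longrightarrow> card (fib (W q) y) = ldeg q"
      using isolates_card_eq_local_degree[of "W q" q] W(1)[OF q] by simp
  qed
  ultimately show ?thesis
  proof eventually_elim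
    case (elim y)
    show ?case
    proof
      assume y: "y \<in> \<Omega>"
      have split: "(\<Sum>q\<in>fib UNIV y. f q) = (\<Sum>p\<in>F. \<Sum>q\<in>fib (W p) y. f q)"
        for f :: "'x \<times> 'x \<Rightarrow> real"
      proof -
        have "fib UNIV y = (\<Union>p\<in>F. fib (W p) y)" using elim(1) by auto
        moreover have "fib (W p) y \<inter> fib (W q) y = {}" if "p \<in> F" "q \<in> F" "p \<noteq> q" for p q
          using W(2)[OF that] by auto
        ultimately show ?thesis
          using finite_fib by (simp only:, intro sum.UNION_disjoint) (simp_all add: F_def finite_fibres)
      qed
      \<comment> \<open>The weight \<open>ldeg p\<close> is spread out as one copy of
        \<open>\<phi> p\<close> for each point of \<open>fib (W p) y\<close>, so the two fibre sums
        can be compared term by term.\<close>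
      have "fibre_sum \<phi> x = (\<Sum>p\<in>F. \<Sum>q\<in>fib (W p) y. \<phi> p)"
        unfolding fibre_sum_def F_def[symmetric] using elim(2) y by (intro sum.cong) auto
      then have "fibre_sum \<phi> y - fibre_sum \<phi> x = (\<Sum>p\<in>F. \<Sum>q\<in>fib (W p) y. \<phi> q - \<phi> p)"
        by (simp only: fibre_sum_unbranched[OF y] split sum_subtractf)
      also have "\<bar>\<dots>\<bar> \<le> (\<Sum>p\<in>F. \<Sum>q\<in>fib (W p) y. e)"
      proof (rule order_trans[OF sum_abs], rule sum_mono, rule order_trans[OF sum_abs], rule sum_mono)
        fix p q assume "p \<in> F" "q \<in> fib (W p) y"
        then have "q \<in> S p" using W(1) by blast
        then show "\<bar>\<phi> q - \<phi> p\<bar> \<le> e" by (simp add: S_def)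
      qed
      also have "\<dots> = (\<Sum>q\<in>fib UNIV y. e)" by (rule split[symmetric])
      also have "\<dots> = e * real \<delta>" using card_fib_UNIV[OF y] by simp
      finally show "\<bar>fibre_sum \<phi> y - fibre_sum \<phi> x\<bar> \<le> e * real \<delta>" .
    qed
  qed
qed

text \<open>This is conservation of number: the local degrees over any point, branched or not, add
  up to \<open>\<delta>\<close>. It passes from generic points to all points by the limit
  estimate.\<close>

lemma fibre_sum_one: "fibre_sum (\<lambda>_. 1) x = real \<delta>"
proof -
  have "\<bar>real \<delta> - fibre_sum (\<lambda>_. 1) x\<bar> \<le> e" if e: "e > 0" for e
  proof -
    \<comment> \<open>Adding \<open>1\<close> keeps the quotient positive when
      \<open>\<delta>\<close> is \<open>0\<close>.\<close>
    have "e / (real \<delta> + 1) > 0" using e by simp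
    from fibre_sum_limit[OF continuous_on_const this, of 1 x]
    obtain y where y: "y \<in> \<Omega>"
      "y \<in> \<Omega> \<longrightarrow> \<bar>fibre_sum (\<lambda>_. 1) y - fibre_sum (\<lambda>_. 1) x\<bar> \<le> e / (real \<delta> + 1) * real \<delta>"
      by (rule eventually_dense)
    have "fibre_sum (\<lambda>_. 1) y = real \<delta>"
      using card_fib_UNIV[OF y(1)] by (simp add: fibre_sum_unbranched[OF y(1)])
    moreover have "e / (real \<delta> + 1) * real \<delta> \<le> e"
      using e by (simp add: divide_le_eq algebra_simps)
    ultimately show ?thesis using mp[OF y(2) y(1)] by linarith
  qed
  then have "\<bar>real \<delta> - fibre_sum (\<lambda>_. 1) x\<bar> \<le> 0" by (rule field_le_epsilon) simp
  then show ?thesis by simp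
qed

text \<open>The limit estimate compares \<open>x\<close> only with points of
  \<open>\<Omega>\<close>. For an arbitrary \<open>y\<close> near \<open>x\<close>, a generic
  \<open>z\<close> close to \<open>y\<close> and still in \<open>V\<close> is compared with
  both.\<close>

lemma continuous_on_fibre_sum:
  assumes "continuous_on UNIV \<phi>"
  shows "continuous_on UNIV (fibre_sum \<phi>)"
  unfolding continuous_on_def
proof (intro ballI)
  fix x
  have "\<forall>\<^sub>F y in nhds x. dist (fibre_sum \<phi> y) (fibre_sum \<phi> x) < e" if e: "e > 0" for e
  proof -
    \<comment> \<open>The factor \<open>3\<close> leaves the sum of two errors, each at most
      \<open>e / 3\<close>, strictly below \<open>e\<close>.\<close>
    define r where "r = e / (3 * (real \<delta> + 1))"
    have r: "r > 0" and r2: "r * real \<delta> \<le> e / 3" using e by (auto simp: r_def field_simps)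
    obtain V where V: "open V" "x \<in> V"
      "\<And>y. y \<in> V \<Longrightarrow> y \<in> \<Omega> \<Longrightarrow> \<bar>fibre_sum \<phi> y - fibre_sum \<phi> x\<bar> \<le> r * real \<delta>"
      using fibre_sum_limit[OF assms r, of x] unfolding eventually_nhds by blast
    have "dist (fibre_sum \<phi> y) (fibre_sum \<phi> x) < e" if y: "y \<in> V" for y
    proof -
      have "\<forall>\<^sub>F z in nhds y. z \<in> V" using V(1) y eventually_nhds by blast
      with fibre_sum_limit[OF assms r, of y]
      have "\<forall>\<^sub>F z in nhds y. z \<in> V \<and> (z \<in> \<Omega> \<longrightarrow> \<bar>fibre_sum \<phi> z - fibre_sum \<phi> y\<bar> \<le> r * real \<delta>)"
        by eventually_elim blast
      then obtain z where "z \<in> \<Omega>"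
          "z \<in> V \<and> (z \<in> \<Omega> \<longrightarrow> \<bar>fibre_sum \<phi> z - fibre_sum \<phi> y\<bar> \<le> r * real \<delta>)"
        by (rule eventually_dense)
      then have z: "z \<in> \<Omega>" "z \<in> V" "\<bar>fibre_sum \<phi> z - fibre_sum \<phi> y\<bar> \<le> r * real \<delta>"
        by blast+
      show ?thesis using V(3)[OF z(2,1)] z(3) r2 e unfolding dist_real_def by linarith
    qed
    then show ?thesis unfolding eventually_nhds using V(1,2) by blast
  qed
  then have "(fibre_sum \<phi> \<longlongrightarrow> fibre_sum \<phi> x) (nhds x)" by (intro tendstoI)
  then show "(fibre_sum \<phi> \<longlongrightarrow> fibre_sum \<phi> x) (at x)" using tendsto_at_iff_tendsto_nhds by blast
qed

end


section \<open>The Riesz representation theorem on a compact space\<close>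

lemma uniform_bound_continuous:
  fixes f :: "'a::topological_space \<Rightarrow> real"
  assumes "compact (UNIV :: 'a set)" "continuous_on UNIV f"
  obtains B where "B > 0" "\<And>x. \<bar>f x\<bar> \<le> B"
proof -
  have "bounded (range f)"
    using assms by (intro compact_imp_bounded compact_continuous_image)
  then obtain B where "\<And>x. \<bar>f x\<bar> \<le> B" unfolding bounded_iff by auto
  then have "\<bar>f x\<bar> \<le> \<bar>B\<bar> + 1" for x using order_trans[of "\<bar>f x\<bar>" B "\<bar>B\<bar> + 1"] by simp
  then show ?thesis by (intro that[of "\<bar>B\<bar> + 1"]) auto
qed

text \<open>\<open>\<Lambda>\<close> is a total function, but only its values at continuous
  functions are constrained; this avoids a separate type of continuous functions.\<close>

locale positive_functional =
  fixes \<Lambda> :: "('x::{t2_space,second_countable_topology} \<Rightarrow> real) \<Rightarrow> real"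
  assumes compact_space: "compact (UNIV :: 'x set)"
    and add: "continuous_on UNIV f \<Longrightarrow> continuous_on UNIV g \<Longrightarrow> \<Lambda> (\<lambda>x. f x + g x) = \<Lambda> f + \<Lambda> g"
    and scale: "continuous_on UNIV f \<Longrightarrow> \<Lambda> (\<lambda>x. c * f x) = c * \<Lambda> f"
    and nonneg: "continuous_on UNIV f \<Longrightarrow> (\<And>x. 0 \<le> f x) \<Longrightarrow> 0 \<le> \<Lambda> f"
    and one: "\<Lambda> (\<lambda>x. 1) = 1"
begin

lemma zero: "\<Lambda> (\<lambda>x. 0) = 0"
  using scale[of "\<lambda>x. 0" 0] by simp

lemma const: "\<Lambda> (\<lambda>x. c) = c"
  using scale[of "\<lambda>x. 1" c] one by simp

lemma diff:
  assumes "continuous_on UNIV f" "continuous_on UNIV g"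
  shows "\<Lambda> (\<lambda>x. f x - g x) = \<Lambda> f - \<Lambda> g"
proof -
  have "continuous_on UNIV (\<lambda>x. f x - g x)" using assms by (intro continuous_intros)
  from add[OF this assms(2)] show ?thesis by simp
qed

lemma mono:
  assumes "continuous_on UNIV f" "continuous_on UNIV g" "\<And>x. f x \<le> g x"
  shows "\<Lambda> f \<le> \<Lambda> g"
proof -
  have "0 \<le> \<Lambda> (\<lambda>x. g x - f x)"
    using assms by (intro nonneg continuous_intros) auto
  then show ?thesis using diff[OF assms(2,1)] by simp
qed

lemma sum:
  assumes "finite I" "\<And>i. i \<in> I \<Longrightarrow> continuous_on UNIV (f i)"
  shows "\<Lambda> (\<lambda>x. \<Sum>i\<in>I. f i x) = (\<Sum>i\<in>I. \<Lambda> (f i))"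
  using assms
proof (induction I rule: finite_induct)
  case empty
  then show ?case by (simp add: zero)
next
  case (insert i I)
  then have "\<Lambda> (\<lambda>x. f i x + (\<Sum>i\<in>I. f i x)) = \<Lambda> (f i) + \<Lambda> (\<lambda>x. \<Sum>i\<in>I. f i x)"
    by (intro add continuous_on_sum) auto
  with insert show ?case by simp
qed

definition nnc :: "('x \<Rightarrow> real) \<Rightarrow> bool" where
  "nnc f \<longleftrightarrow> continuous_on UNIV f \<and> (\<forall>x. 0 \<le> f x)"

lemma nncD: "nnc f \<Longrightarrow> continuous_on UNIV f" "nnc f \<Longrightarrow> 0 \<le> f x" "nnc f \<Longrightarrow> 0 \<le> \<Lambda> f"
  by (auto simp: nnc_def intro: nonneg)

text \<open>Dini's argument; it makes the outer measure below agree with \<open>\<Lambda>\<close> on the whole space.\<close>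

lemma countable_subadditive:
  assumes g: "nnc g" and f: "\<And>n. nnc (f n)"
    and le: "\<And>x. ennreal (g x) \<le> (\<Sum>n. ennreal (f n x))"
  shows "ennreal (\<Lambda> g) \<le> (\<Sum>n. ennreal (\<Lambda> (f n)))"
proof (rule ennreal_le_epsilon)
  fix e :: real assume e: "0 < e"
  define S where "S N x = (\<Sum>n<N. f n x)" for N x
  define W where "W N = {x. g x - e < S N x}" for N
  have contS: "continuous_on UNIV (S N)" for N
    unfolding S_def by (intro continuous_on_sum nncD f)
  have "open (W N)" for N
    unfolding W_def by (intro open_Collect_less continuous_intros nncD g contS)
  moreover have "\<exists>N. x \<in> W N" for x
  proof (cases "g x < e")
    case True
    then show ?thesis by (intro exI[of _ 0]) (simp add: W_def S_def)
  next
    case False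
    \<comment> \<open>The slack \<open>e\<close> makes the bound by the infinite series strict, so a
      finite partial sum already attains it; hence the open sets \<open>W N\<close> cover the
      space.\<close>
    then have "ennreal (g x - e) < ennreal (g x)" using e by (intro ennreal_lessI) auto
    also have "\<dots> \<le> (\<Sum>n. ennreal (f n x))" by (rule le)
    also have "\<dots> = (SUP N. \<Sum>n<N. ennreal (f n x))" by (rule suminf_eq_SUP)
    finally obtain N where "ennreal (g x - e) < (\<Sum>n<N. ennreal (f n x))"
      unfolding less_SUP_iff by blast
    also have "\<dots> = ennreal (S N x)"
      unfolding S_def by (rule sum_ennreal) (use f nncD in auto)
    finally have "g x - e < S N x" using False by (simp add: ennreal_less_iff)
    then show ?thesis by (auto simp: W_def)
  qed
  ultimately obtain I where I: "finite I" "UNIV \<subseteq> (\<Union>N\<in>I. W N)"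
    using compactE_image[OF compact_space, of UNIV W] by (metis UNIV_I UN_iff subsetI subset_UNIV)
  define M where "M = Max (insert 0 I)"
  have "g x - e \<le> S M x" for x
  proof -
    obtain N where N: "N \<in> I" "x \<in> W N" using I by blast
    then have "N \<le> M" unfolding M_def using I by simp
    then have "S N x \<le> S M x" unfolding S_def using nncD f by (intro sum_mono2) auto
    then show ?thesis using N by (auto simp: W_def)
  qed
  then have "\<Lambda> (\<lambda>x. g x - e) \<le> \<Lambda> (S M)"
    by (intro mono contS continuous_intros nncD g)
  then have "\<Lambda> g \<le> \<Lambda> (S M) + e"
    using diff[OF nncD(1)[OF g] continuous_on_const, of e] const[of e] by simp
  also have "\<Lambda> (S M) = (\<Sum>n<M. \<Lambda> (f n))"
    unfolding S_def by (intro sum nncD f) auto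
  finally have "ennreal (\<Lambda> g) \<le> ennreal ((\<Sum>n<M. \<Lambda> (f n)) + e)" by (rule ennreal_leI)
  also have "\<dots> = ennreal (\<Sum>n<M. \<Lambda> (f n)) + ennreal e"
    using e f nncD by (intro ennreal_plus sum_nonneg) auto
  also have "ennreal (\<Sum>n<M. \<Lambda> (f n)) = (\<Sum>n<M. ennreal (\<Lambda> (f n)))"
    by (rule sum_ennreal[symmetric]) (use f nncD in auto)
  also have "\<dots> \<le> (\<Sum>n. ennreal (\<Lambda> (f n)))"
    by (intro sum_le_suminf) auto
  finally show "ennreal (\<Lambda> g) \<le> (\<Sum>n. ennreal (\<Lambda> (f n))) + ennreal e" by simp
qed

section \<open>The outer measure of a positive functional\<close>

definition covers :: "'x set \<Rightarrow> (nat \<Rightarrow> 'x \<Rightarrow> real) \<Rightarrow> bool" where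
  "covers A f \<longleftrightarrow> (\<forall>n. nnc (f n)) \<and> (\<forall>x\<in>A. 1 \<le> (\<Sum>n. ennreal (f n x)))"

text \<open>An upper integral of the indicator of \<open>A\<close>, in the manner of Daniell. Series
  of functions are used because a single continuous function that is at least \<open>1\<close> on
  \<open>A\<close> is so on the closure of \<open>A\<close> too.\<close>

definition outer :: "'x set \<Rightarrow> ennreal" where
  "outer A = (INF f\<in>{f. covers A f}. \<Sum>n. ennreal (\<Lambda> (f n)))"

lemma outer_le: "covers A f \<Longrightarrow> outer A \<le> (\<Sum>n. ennreal (\<Lambda> (f n)))"
  unfolding outer_def by (auto intro: INF_lower)

lemma outer_le_single:
  assumes "nnc f" "\<And>x. x \<in> A \<Longrightarrow> 1 \<le> f x"
  shows "outer A \<le> ennreal (\<Lambda> f)"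
proof -
  define g where "g n = (if n = 0 then f else (\<lambda>x. 0))" for n :: nat
  have eq: "(\<Sum>n. if n = 0 then c else 0) = c" for c :: ennreal
    using suminf_finite[of "{0::nat}" "\<lambda>n. if n = 0 then c else 0"] by simp
  have "ennreal (g n x) = (if n = 0 then ennreal (f x) else 0)" for n x by (simp add: g_def)
  then have "covers A g"
    using assms by (auto simp: covers_def eq) (auto simp: g_def nnc_def)
  then have "outer A \<le> (\<Sum>n. ennreal (\<Lambda> (g n)))" by (rule outer_le)
  also have "(\<lambda>n. ennreal (\<Lambda> (g n))) = (\<lambda>n. if n = 0 then ennreal (\<Lambda> f) else 0)"
    by (auto simp: g_def zero)
  finally show ?thesis by (simp add: eq)
qed

lemma outer_UNIV: "outer UNIV = 1"
proof (rule antisym)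
  show "outer UNIV \<le> 1"
    using outer_le_single[of "\<lambda>x. 1" UNIV] by (simp add: nnc_def one)
  show "1 \<le> outer UNIV"
    unfolding outer_def
  proof (intro INF_greatest, clarify)
    fix f assume "covers UNIV f"
    then have "ennreal (\<Lambda> (\<lambda>x. 1)) \<le> (\<Sum>n. ennreal (\<Lambda> (f n)))"
      by (intro countable_subadditive) (auto simp: covers_def nnc_def)
    then show "1 \<le> (\<Sum>n. ennreal (\<Lambda> (f n)))" by (simp add: one)
  qed
qed

lemma outer_mono: "A \<subseteq> B \<Longrightarrow> outer A \<le> outer B"
  unfolding outer_def by (rule INF_superset_mono) (auto simp: covers_def subset_iff)

lemma outer_le_1: "outer A \<le> 1"
  using outer_mono[of A UNIV] by (simp add: outer_UNIV)

text \<open>The pairing function turns a double family into one cover. This serves both the union of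
  countably many covers and the refinement of one cover into layers.\<close>

lemma outer_double_le:
  assumes h: "\<And>n j. nnc (h n j)"
    and "\<And>x. x \<in> A \<Longrightarrow> 1 \<le> (\<Sum>n. \<Sum>j. ennreal (h n j x))"
  shows "outer A \<le> (\<Sum>n. \<Sum>j. ennreal (\<Lambda> (h n j)))"
proof -
  define f where "f k = h (fst (prod_decode k)) (snd (prod_decode k))" for k
  have eq: "(\<Sum>k. F (fst (prod_decode k)) (snd (prod_decode k))) = (\<Sum>n. \<Sum>j. F n j)"
    for F :: "nat \<Rightarrow> nat \<Rightarrow> ennreal"
    using suminf_ennreal_2dimen[of "\<lambda>n. \<Sum>j. F n j" "\<lambda>p. F (fst p) (snd p)"] by simp
  have "covers A f"
    unfolding covers_def f_def using assms eq[of "\<lambda>n j. ennreal (h n j _)"] by auto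
  then show ?thesis
    using outer_le[of A f] eq[of "\<lambda>n j. ennreal (\<Lambda> (h n j))"] by (simp add: f_def)
qed

lemma outer_UN_le: "outer (\<Union>i. A i) \<le> (\<Sum>i. outer (A i))"
proof (rule ennreal_le_epsilon)
  fix e :: real assume e: "0 < e"
  have "\<exists>f. covers (A i) f \<and> (\<Sum>n. ennreal (\<Lambda> (f n))) \<le> outer (A i) + ennreal (e * (1/2)^Suc i)" for i
  proof -
    \<comment> \<open>Finiteness is what makes the addition of a positive amount strict in
      \<open>ennreal\<close>.\<close>
    have "outer (A i) < top" using outer_le_1[of "A i"] by (rule order.strict_trans1) simp
    moreover have "0 < ennreal (e * (1/2)^Suc i)" using e by simp
    ultimately have "outer (A i) + 0 < outer (A i) + ennreal (e * (1/2)^Suc i)"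
      by (subst ennreal_add_left_cancel_less) auto
    then have "(INF f\<in>{f. covers (A i) f}. \<Sum>n. ennreal (\<Lambda> (f n)))
        < outer (A i) + ennreal (e * (1/2)^Suc i)"
      by (simp only: add_0_right flip: outer_def)
    then obtain f where "covers (A i) f"
        "(\<Sum>n. ennreal (\<Lambda> (f n))) < outer (A i) + ennreal (e * (1/2)^Suc i)"
      unfolding INF_less_iff by blast
    then show ?thesis by (auto intro: less_imp_le)
  qed
  then obtain f where f: "\<And>i. covers (A i) (f i)"
    "\<And>i. (\<Sum>n. ennreal (\<Lambda> (f i n))) \<le> outer (A i) + ennreal (e * (1/2)^Suc i)"
    by metis
  have "outer (\<Union>i. A i) \<le> (\<Sum>i. \<Sum>n. ennreal (\<Lambda> (f i n)))"
  proof (rule outer_double_le)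
    show "nnc (f i n)" for i n using f(1) by (auto simp: covers_def)
    fix x assume "x \<in> (\<Union>i. A i)"
    then obtain i where "x \<in> A i" by blast
    then have "1 \<le> (\<Sum>n. ennreal (f i n x))" using f(1)[of i] by (auto simp: covers_def)
    also have "\<dots> = (\<Sum>i\<in>{i}. \<Sum>n. ennreal (f i n x))" by simp
    also have "\<dots> \<le> (\<Sum>i. \<Sum>n. ennreal (f i n x))"
      by (intro sum_le_suminf) auto
    finally show "1 \<le> (\<Sum>i. \<Sum>n. ennreal (f i n x))" .
  qed
  also have "\<dots> \<le> (\<Sum>i. outer (A i) + ennreal (e * (1/2)^Suc i))"
    by (intro suminf_le f(2)) auto
  also have "\<dots> = (\<Sum>i. outer (A i)) + (\<Sum>i. ennreal (e * (1/2)^Suc i))"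
    by (rule suminf_add[symmetric]) auto
  also have "(\<Sum>i. ennreal (e * (1/2)^Suc i)) = ennreal e"
    using e sums_mult[OF power_half_series, of e] by (intro suminf_ennreal_eq) auto
  finally show "outer (\<Union>i. A i) \<le> (\<Sum>i. outer (A i)) + ennreal e" by simp
qed

lemma outer_measure: "outer_measure_space UNIV outer"
  unfolding outer_measure_space_def
proof (intro conjI)
  show "positive UNIV outer"
    using outer_le_single[of "\<lambda>x. 0" "{}"] by (simp add: positive_def nnc_def zero)
  show "increasing UNIV outer" by (auto simp: increasing_def outer_mono)
  show "countably_subadditive UNIV outer"
    by (auto simp: countably_subadditive_def outer_UN_le)
qed

section \<open>Caratheodory measurability of open sets\<close>

definition msets :: "'x set set" where
  "msets = lambda_system UNIV UNIV outer"

lemma measure_space_outer: "measure_space UNIV msets outer"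
proof -
  interpret sigma_algebra "UNIV :: 'x set" UNIV
    using sigma_algebra_Pow[of "UNIV :: 'x set"] by simp
  show ?thesis unfolding msets_def by (rule caratheodory_lemma[OF outer_measure])
qed

lemma outer_split_le:
  "outer E \<le> outer (E \<inter> U) + outer (E - U)"
proof -
  define A where "A i = (if i = 0 then E \<inter> U else if i = 1 then E - U else {})" for i :: nat
  have 0: "outer {} = 0" using outer_measure by (simp add: outer_measure_space_def positive_def)
  have "E = (\<Union>i. A i)"
  proof (intro equalityI subsetI)
    fix x assume "x \<in> E"
    then have "x \<in> A 0 \<or> x \<in> A 1" by (auto simp: A_def)
    then show "x \<in> (\<Union>i. A i)" by blast
  qed (auto simp: A_def split: if_splits)
  then have "outer E \<le> (\<Sum>i. outer (A i))" using outer_UN_le[of A] by simp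
  also have "\<dots> = (\<Sum>i\<in>{0,1}. outer (A i))"
    by (rule suminf_finite) (auto simp: A_def 0)
  also have "\<dots> = outer (E \<inter> U) + outer (E - U)" by (simp add: A_def)
  finally show ?thesis .
qed

text \<open>
  With \<open>U = {x. 0 < g x}\<close>, the functions \<open>u j\<close> increase to the indicator of \<open>U\<close>. Each \<open>f n\<close> of a cover
  of \<open>E\<close> splits into the series of the \<open>f n * (u (Suc j) - u j)\<close>, which cover \<open>E \<inter> U\<close>, while the
  \<open>f n * (1 - u J)\<close> cover \<open>E - U\<close> for each \<open>J\<close>.
\<close>

lemma cozero_msets:
  assumes g: "nnc g"
  shows "{x. 0 < g x} \<in> msets"
proof -
  define U where "U = {x. 0 < g x}"
  define u where "u j x = min 1 (real j * g x)" for j x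
  have u: "continuous_on UNIV (u j)" "0 \<le> u j x" "u j x \<le> 1" "u j x \<le> u (Suc j) x" for j x
  proof -
    have "real j * g x \<le> real (Suc j) * g x" using nncD(2)[OF g] by (intro mult_right_mono) auto
    then show "u j x \<le> u (Suc j) x" unfolding u_def by linarith
  qed (use nncD[OF g] in \<open>auto simp: u_def intro!: continuous_intros\<close>)
  have uU: "u j x = 0" if "x \<notin> U" for j x
  proof -
    have "g x = 0" using that nncD(2)[OF g, of x] by (simp add: U_def)
    then show ?thesis by (simp add: u_def)
  qed
  have "outer (E \<inter> U) + outer (E - U) \<le> outer E" for E
    unfolding outer_def[of E]
  proof (intro INF_greatest, clarify)
    fix f assume cov: "covers E f"
    then have f: "nnc (f n)" for n by (auto simp: covers_def)
    define h where "h n j = (\<lambda>x. f n x * (u (Suc j) x - u j x))" for n j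
    have h: "nnc (h n j)" for n j
      using f[of n] u unfolding nnc_def h_def by (auto intro!: continuous_intros)
    have fu: "nnc (\<lambda>x. f n x * u j x)" for n j
      using f[of n] u unfolding nnc_def by (auto intro!: continuous_intros)
    have fu': "nnc (\<lambda>x. f n x * (1 - u j x))" for n j
      using f[of n] u unfolding nnc_def by (auto intro!: continuous_intros)
    have hsum: "(\<Sum>j<J. h n j x) = f n x * u J x" for n J x
    proof -
      have "(\<Sum>j<J. h n j x) = f n x * (\<Sum>j<J. u (Suc j) x - u j x)"
        by (simp add: h_def sum_distrib_left)
      also have "(\<Sum>j<J. u (Suc j) x - u j x) = u J x - u 0 x" by (rule sum_lessThan_telescope)
      finally show ?thesis by (simp add: u_def)
    qed
    have "outer (E \<inter> U) \<le> (\<Sum>n. \<Sum>j. ennreal (\<Lambda> (h n j)))"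
    proof (rule outer_double_le[OF h])
      fix x assume x: "x \<in> E \<inter> U"
      \<comment> \<open>From this \<open>J\<close> on, \<open>u\<close> has reached the value
        \<open>1\<close> at \<open>x\<close>, so the first \<open>J\<close> layers of
        \<open>f n\<close> already recover \<open>f n x\<close>.\<close>
      then obtain J where "1 / g x < real J" using reals_Archimedean2 by blast
      then have uJ: "u J x = 1" using x by (simp add: U_def u_def field_simps)
      have "1 \<le> (\<Sum>n. ennreal (f n x))" using cov x by (auto simp: covers_def)
      also have "\<dots> \<le> (\<Sum>n. \<Sum>j. ennreal (h n j x))"
      proof (intro suminf_le)
        fix n
        have "ennreal (f n x) = ennreal (\<Sum>j<J. h n j x)" by (simp add: hsum uJ)
        also have "\<dots> = (\<Sum>j<J. ennreal (h n j x))"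
          by (rule sum_ennreal[symmetric]) (use h nncD in auto)
        also have "\<dots> \<le> (\<Sum>j. ennreal (h n j x))" by (intro sum_le_suminf) auto
        finally show "ennreal (f n x) \<le> (\<Sum>j. ennreal (h n j x))" .
      qed auto
      finally show "1 \<le> (\<Sum>n. \<Sum>j. ennreal (h n j x))" .
    qed
    also have "\<dots> = (\<Sum>n. SUP J. ennreal (\<Lambda> (\<lambda>x. f n x * u J x)))"
    proof (rule arg_cong[where f=suminf], rule ext)
      fix n
      have "(\<Sum>j<J. ennreal (\<Lambda> (h n j))) = ennreal (\<Lambda> (\<lambda>x. f n x * u J x))" for J
      proof -
        have "(\<Sum>j<J. ennreal (\<Lambda> (h n j))) = ennreal (\<Sum>j<J. \<Lambda> (h n j))"
          by (rule sum_ennreal) (use h nncD in auto)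
        also have "(\<Sum>j<J. \<Lambda> (h n j)) = \<Lambda> (\<lambda>x. \<Sum>j<J. h n j x)"
          by (rule sum[symmetric]) (use h nncD in auto)
        finally show ?thesis by (simp add: hsum)
      qed
      then show "(\<Sum>j. ennreal (\<Lambda> (h n j))) = (SUP J. ennreal (\<Lambda> (\<lambda>x. f n x * u J x)))"
        by (simp add: suminf_eq_SUP)
    qed
    also have "\<dots> = (SUP J. \<Sum>n. ennreal (\<Lambda> (\<lambda>x. f n x * u J x)))"
    proof (rule ennreal_suminf_SUP_eq)
      fix n show "incseq (\<lambda>J. ennreal (\<Lambda> (\<lambda>x. f n x * u J x)))"
        by (intro incseq_SucI ennreal_leI mono nncD fu mult_left_mono u f)
    qed
    finally have "outer (E \<inter> U) + outer (E - U)
        \<le> (SUP J. \<Sum>n. ennreal (\<Lambda> (\<lambda>x. f n x * u J x))) + outer (E - U)"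
      by (rule add_right_mono)
    \<comment> \<open>With the supremum outside, \<open>E - U\<close> can be covered for each fixed
      \<open>J\<close> by the functions that complement the truncated layers; the two sums then
      recombine to that of \<open>f n\<close>.\<close>
    also have "\<dots> = (SUP J. (\<Sum>n. ennreal (\<Lambda> (\<lambda>x. f n x * u J x))) + outer (E - U))"
      by (rule ennreal_SUP_add_left[symmetric]) simp
    also have "\<dots> \<le> (\<Sum>n. ennreal (\<Lambda> (f n)))"
    proof (rule SUP_least)
      fix J
      have "outer (E - U) \<le> (\<Sum>n. ennreal (\<Lambda> (\<lambda>x. f n x * (1 - u J x))))"
        using fu' cov uU by (intro outer_le) (auto simp: covers_def)
      then have "(\<Sum>n. ennreal (\<Lambda> (\<lambda>x. f n x * u J x))) + outer (E - U)
          \<le> (\<Sum>n. ennreal (\<Lambda> (\<lambda>x. f n x * u J x))) + (\<Sum>n. ennreal (\<Lambda> (\<lambda>x. f n x * (1 - u J x))))"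
        by (rule add_left_mono)
      also have "\<dots> = (\<Sum>n. ennreal (\<Lambda> (\<lambda>x. f n x * u J x)) + ennreal (\<Lambda> (\<lambda>x. f n x * (1 - u J x))))"
        by (rule suminf_add) auto
      also have "\<dots> = (\<Sum>n. ennreal (\<Lambda> (f n)))"
      proof (rule arg_cong[where f=suminf], rule ext)
        fix n
        have "\<Lambda> (\<lambda>x. f n x * u J x + f n x * (1 - u J x)) = \<Lambda> (\<lambda>x. f n x * u J x) + \<Lambda> (\<lambda>x. f n x * (1 - u J x))"
          by (rule add) (use fu fu' nncD in auto)
        then show "ennreal (\<Lambda> (\<lambda>x. f n x * u J x)) + ennreal (\<Lambda> (\<lambda>x. f n x * (1 - u J x))) = ennreal (\<Lambda> (f n))"
          using nncD(3)[OF fu] nncD(3)[OF fu'] by (simp add: algebra_simps flip: ennreal_plus)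
      qed
      finally show "(\<Sum>n. ennreal (\<Lambda> (\<lambda>x. f n x * u J x))) + outer (E - U) \<le> (\<Sum>n. ennreal (\<Lambda> (f n)))" .
    qed
    finally show "outer (E \<inter> U) + outer (E - U) \<le> (\<Sum>n. ennreal (\<Lambda> (f n)))" .
  qed
  then have "outer (E \<inter> U) + outer (E - U) = outer E" for E
    using outer_split_le antisym by blast
  then show ?thesis
    unfolding msets_def lambda_system_def U_def by (simp add: Int_commute Diff_eq)
qed

text \<open>Urysohn's lemma puts a cozero neighbourhood of each point inside \<open>S\<close>;
  second countability leaves countably many of them.\<close>

lemma open_msets:
  assumes "open S"
  shows "S \<in> msets"
proof -
  interpret M: sigma_algebra UNIV msets
    using measure_space_outer by (simp add: measure_space_def)
  have normal: "normal_space (euclidean :: 'x topology)"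
    using compact_space by (intro compact_Hausdorff_or_regular_imp_normal_space)
      (auto simp: compact_space_def Hausdorff_space_def disjnt_def separation_t2)
  have "\<exists>g. nnc g \<and> 0 < g x \<and> {y. 0 < g y} \<subseteq> S" if x: "x \<in> S" for x
  proof -
    have "closedin euclidean {x}" "closedin euclidean (- S)" "disjnt {x} (- S)"
      using assms x by (auto simp: disjnt_def)
    then obtain g where g: "continuous_map euclidean (top_of_set {0..1::real}) g"
        "g ` {x} \<subseteq> {1}" "g ` (- S) \<subseteq> {0}"
      using Urysohn_lemma[OF normal, of "- S" "{x}" 0 1] by (metis disjnt_sym zero_le_one)
    then have "nnc g" "0 < g x" "{y. 0 < g y} \<subseteq> S"
      by (auto simp: nnc_def continuous_map_in_subtopology)
    then show ?thesis by blast
  qed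
  then obtain g where g: "\<And>x. x \<in> S \<Longrightarrow> nnc (g x) \<and> 0 < g x x \<and> {y. 0 < g x y} \<subseteq> S" by metis
  define \<F> where "\<F> = (\<lambda>x. {y. 0 < g x y}) ` S"
  have "open T" if "T \<in> \<F>" for T
    using that g nncD unfolding \<F>_def by (auto intro!: open_Collect_less continuous_on_const)
  then obtain \<F>' where F: "\<F>' \<subseteq> \<F>" "countable \<F>'" "\<Union>\<F>' = \<Union>\<F>"
    using Lindelof[of \<F>] by blast
  have "\<Union>\<F> = S" using g by (auto simp: \<F>_def)
  moreover have "\<F> \<subseteq> msets" using g cozero_msets by (auto simp: \<F>_def)
  ultimately show ?thesis using M.countable_Union[OF F(2)] F by auto
qed

section \<open>The representing measure\<close>

definition rep_measure :: "'x measure" where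
  "rep_measure = measure_of UNIV (sets borel) outer"

lemma sets_rep [simp, measurable_cong]: "sets rep_measure = sets borel"
  and space_rep [simp]: "space rep_measure = UNIV"
  by (simp_all add: rep_measure_def) (metis sets.sigma_sets_eq space_borel)

lemma borel_msets: "sets borel \<subseteq> msets"
proof -
  interpret M: sigma_algebra UNIV msets
    using measure_space_outer by (simp add: measure_space_def)
  have "sigma_sets UNIV {S. open S} \<subseteq> msets"
    by (rule M.sigma_sets_subset) (auto intro: open_msets)
  then show ?thesis by (simp add: borel_def)
qed

lemma emeasure_rep: "A \<in> sets borel \<Longrightarrow> emeasure rep_measure A = outer A"
  unfolding rep_measure_def
proof (rule emeasure_measure_of[OF refl])
  show "positive (sets (measure_of UNIV (sets borel) outer)) outer"
    using measure_space_outer by (simp add: measure_space_def positive_def)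
  show "countably_additive (sets (measure_of UNIV (sets borel) outer)) outer"
  proof -
    have "countably_additive msets outer" using measure_space_outer by (simp add: measure_space_def)
    then have "countably_additive (sets borel) outer"
      using borel_msets unfolding countably_additive_def by blast
    then show ?thesis using sets_rep by (simp add: rep_measure_def)
  qed
  show "A \<in> sets borel \<Longrightarrow> A \<in> sets (measure_of UNIV (sets borel) outer)"
    using sets_rep by (simp add: rep_measure_def)
qed auto

lemma prob_space_rep: "prob_space rep_measure"
  by (rule prob_spaceI) (simp add: emeasure_rep outer_UNIV)

lemma borel_measurable_cont: "continuous_on UNIV (f :: 'x \<Rightarrow> real) \<Longrightarrow> f \<in> borel_measurable rep_measure"
  by (simp add: borel_measurable_continuous_onI cong: measurable_cong_sets)

lemma integrable_rep:
  assumes "continuous_on UNIV (f :: 'x \<Rightarrow> real)"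
  shows "integrable rep_measure f"
proof -
  interpret prob_space rep_measure by (rule prob_space_rep)
  obtain B where "\<And>x. \<bar>f x\<bar> \<le> B" using uniform_bound_continuous[OF compact_space assms] by blast
  then show ?thesis
    by (intro integrable_const_bound[of _ B]) (auto simp: borel_measurable_cont assms)
qed

text \<open>Slicing \<open>f\<close> horizontally into \<open>N\<close> layers of height \<open>1/N\<close>.\<close>

lemma integral_rep_le:
  assumes f: "continuous_on UNIV f" "\<And>x. 0 \<le> f x" "\<And>x. f x \<le> 1"
  shows "integral\<^sup>L rep_measure f \<le> \<Lambda> f"
proof -
  interpret prob_space rep_measure by (rule prob_space_rep)
  have approx: "integral\<^sup>L rep_measure f \<le> 1 / real N + \<Lambda> f" if N: "N > 0" for N :: nat
  proof -
    define A where "A k = {x. real k / real N \<le> f x}" for k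
    define s where "s k x = min (f x) (real (Suc k) / real N) - min (f x) (real k / real N)" for k x
    have A: "A k \<in> sets borel" for k
      unfolding A_def by (intro borel_closed closed_Collect_le continuous_on_const f)
    have s: "nnc (s k)" for k
    proof -
      have "real k / real N \<le> real (Suc k) / real N" by (intro divide_right_mono) auto
      then have "0 \<le> s k x" for x unfolding s_def by linarith
      moreover have "continuous_on UNIV (s k)"
        unfolding s_def using f(1) by (intro continuous_intros)
      ultimately show ?thesis by (simp add: nnc_def)
    qed
    have sum_s: "(\<Sum>k<N. s k x) = f x" for x
    proof -
      have "(\<Sum>k<N. s k x) = min (f x) (real N / real N) - min (f x) (real 0 / real N)"
        unfolding s_def by (rule sum_lessThan_telescope)
      then show ?thesis using N f(2,3) by simp
    qed
    \<comment> \<open>Each layer lies between \<open>1 / N\<close> times the indicators of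
      \<open>A (Suc k)\<close> and of \<open>A k\<close>. This upper half bounds the integral of
      \<open>f\<close>; the lower half, in \<open>meas\<close>, bounds measures by
      \<open>\<Lambda>\<close>.\<close>
    have s_le: "s k x \<le> indicat_real (A k) x / real N" for k x
      using N by (auto simp: s_def A_def indicator_def min_def field_simps)
    have meas: "measure rep_measure (A (Suc k)) \<le> real N * \<Lambda> (s k)" for k
    proof -
      have "outer (A (Suc k)) \<le> ennreal (\<Lambda> (\<lambda>x. real N * s k x))"
      proof (rule outer_le_single)
        show "nnc (\<lambda>x. real N * s k x)" using s[of k] by (auto simp: nnc_def intro!: continuous_intros)
        fix x assume "x \<in> A (Suc k)"
        then have "real (Suc k) / real N \<le> f x" by (simp add: A_def)
        moreover have "real k / real N \<le> real (Suc k) / real N" by (simp add: divide_right_mono)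
        ultimately have "s k x = real (Suc k) / real N - real k / real N" unfolding s_def by linarith
        then show "1 \<le> real N * s k x" using N by (simp add: field_simps)
      qed
      also have "\<Lambda> (\<lambda>x. real N * s k x) = real N * \<Lambda> (s k)" by (intro scale nncD s)
      finally have "emeasure rep_measure (A (Suc k)) \<le> ennreal (real N * \<Lambda> (s k))"
        using A by (simp add: emeasure_rep)
      then show ?thesis
        unfolding emeasure_eq_measure using nncD(3)[OF s] by (subst (asm) ennreal_le_iff) auto
    qed
    have "integral\<^sup>L rep_measure f \<le> (\<integral>x. (\<Sum>k<N. indicat_real (A k) x / real N) \<partial>rep_measure)"
    proof (rule integral_mono)
      show "f x \<le> (\<Sum>k<N. indicat_real (A k) x / real N)" for x
        using sum_s[of x] sum_mono[of "{..<N}" "\<lambda>k. s k x", OF s_le] by simp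
      show "integrable rep_measure (\<lambda>x. \<Sum>k<N. indicat_real (A k) x / real N)"
        by (intro Bochner_Integration.integrable_sum integrable_divide integrable_real_indicator)
          (auto simp: A emeasure_eq_measure)
    qed (rule integrable_rep[OF f(1)])
    also have "\<dots> = (\<Sum>k<N. measure rep_measure (A k) / real N)"
    proof (subst Bochner_Integration.integral_sum)
      show "integrable rep_measure (\<lambda>x. indicat_real (A k) x / real N)" for k
        by (intro integrable_divide integrable_real_indicator) (auto simp: A emeasure_eq_measure)
    qed (use A in simp)
    \<comment> \<open>The shift by one passes to the sets controlled by \<open>meas\<close>. It
      costs only the term of \<open>A 0\<close>, at most \<open>1 / N\<close>.\<close>
    also have "\<dots> \<le> measure rep_measure (A 0) / real N + (\<Sum>k<N. measure rep_measure (A (Suc k)) / real N)"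
      using sum.lessThan_Suc_shift[of "\<lambda>k. measure rep_measure (A k) / real N" N]
        sum.lessThan_Suc[of "\<lambda>k. measure rep_measure (A k) / real N" N]
        divide_nonneg_nonneg[OF measure_nonneg[of rep_measure "A N"] of_nat_0_le_iff[of N]]
      by linarith
    also have "\<dots> \<le> 1 / real N + (\<Sum>k<N. \<Lambda> (s k))"
      using meas N by (intro add_mono sum_mono divide_right_mono) (auto simp: field_simps)
    also have "(\<Sum>k<N. \<Lambda> (s k)) = \<Lambda> (\<lambda>x. \<Sum>k<N. s k x)"
      by (rule sum[symmetric]) (use s nncD in auto)
    finally show ?thesis by (simp add: sum_s)
  qed
  have "(\<lambda>n. 1 / real (Suc n) + \<Lambda> f) \<longlonglongrightarrow> 0 + \<Lambda> f"
    by (intro tendsto_intros LIMSEQ_inverse_real_of_nat[unfolded inverse_eq_divide])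
  then show ?thesis
    using approx by (intro LIMSEQ_le_const[of _ "\<Lambda> f"]) (auto simp del: of_nat_Suc)
qed

text \<open>The one-sided bound for values in \<open>[0, 1]\<close> gives equality when applied also
  to \<open>1 - g\<close>, since both sides give \<open>1\<close> the value \<open>1\<close>. An
  affine rescaling reaches every continuous function.\<close>

theorem integral_rep:
  assumes f: "continuous_on UNIV f"
  shows "integral\<^sup>L rep_measure f = \<Lambda> f"
proof -
  interpret prob_space rep_measure by (rule prob_space_rep)
  have unit: "integral\<^sup>L rep_measure g = \<Lambda> g"
    if g: "continuous_on UNIV g" "\<And>x. 0 \<le> g x" "\<And>x. g x \<le> 1" for g
  proof -
    have c: "continuous_on UNIV (\<lambda>x. 1 - g x)" using g by (intro continuous_intros)
    have "integral\<^sup>L rep_measure (\<lambda>x. 1 - g x) \<le> \<Lambda> (\<lambda>x. 1 - g x)"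
      using g c by (intro integral_rep_le) auto
    also have "\<dots> = 1 - \<Lambda> g" using diff[of "\<lambda>x. 1" g] g by (simp add: one)
    also have "integral\<^sup>L rep_measure (\<lambda>x. 1 - g x) = 1 - integral\<^sup>L rep_measure g"
      using integrable_rep[OF g(1)] by (simp add: prob_space[simplified])
    finally show ?thesis using integral_rep_le[OF g] by simp
  qed
  obtain B where B: "B > 0" "\<And>x. \<bar>f x\<bar> \<le> B" using uniform_bound_continuous[OF compact_space f] by blast
  \<comment> \<open>The affine map sends \<open>[-B, B]\<close> onto \<open>[0, 1]\<close>.\<close>
  define g where "g x = (1 / (2 * B)) * f x + 1 / 2" for x
  have "integral\<^sup>L rep_measure g = \<Lambda> g"
  proof (rule unit)
    show "continuous_on UNIV g" unfolding g_def using f by (intro continuous_intros)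
    show "0 \<le> g x" "g x \<le> 1" for x
      using B(1) B(2)[of x] unfolding g_def by (auto simp: field_simps)
  qed
  moreover have "integral\<^sup>L rep_measure g = (1 / (2 * B)) * integral\<^sup>L rep_measure f + 1 / 2"
    unfolding g_def using integrable_rep[OF f] by (simp add: prob_space[simplified])
  moreover have "\<Lambda> g = (1 / (2 * B)) * \<Lambda> f + 1 / 2"
  proof -
    have "\<Lambda> g = \<Lambda> (\<lambda>x. (1 / (2 * B)) * f x) + \<Lambda> (\<lambda>x. 1 / 2)"
      unfolding g_def using f by (intro add continuous_intros)
    then show ?thesis by (simp only: scale[OF f] const)
  qed
  ultimately show ?thesis using B(1) by simp
qed

end


section \<open>Invariant functionals and invariant measures\<close>

text \<open>
  The Krylov--Bogoliubov argument: the Cesaro means of the orbit of a point evaluation have a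
  cluster point in a product of compact intervals, by Tychonoff's theorem.
\<close>

lemma invariant_functional_exists:
  fixes T :: "('x::{t2_space,second_countable_topology} \<Rightarrow> real) \<Rightarrow> 'x \<Rightarrow> real"
  assumes comp: "compact (UNIV :: 'x set)"
    and cont: "\<And>f. continuous_on UNIV f \<Longrightarrow> continuous_on UNIV (T f)"
    and add: "\<And>f g. T (\<lambda>x. f x + g x) = (\<lambda>x. T f x + T g x)"
    and scale: "\<And>c f. T (\<lambda>x. c * f x) = (\<lambda>x. c * T f x)"
    and nonneg: "\<And>f x. (\<And>y. 0 \<le> f y) \<Longrightarrow> 0 \<le> T f x"
    and one: "T (\<lambda>x. 1) = (\<lambda>x. 1)"
  obtains \<Lambda> where "positive_functional \<Lambda>" "\<And>f. continuous_on UNIV f \<Longrightarrow> \<Lambda> (T f) = \<Lambda> f"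
proof -
  \<comment> \<open>\<open>undefined\<close> serves as an arbitrary base point of the space.\<close>
  define P where "P n f = (T ^^ n) f undefined" for n f
  have contn: "continuous_on UNIV ((T ^^ n) f)" if "continuous_on UNIV f" for n f
    by (induction n) (auto simp: that cont)
  have addn: "(T ^^ n) (\<lambda>x. f x + g x) = (\<lambda>x. (T ^^ n) f x + (T ^^ n) g x)" for n f g
    by (induction n) (auto simp: add)
  have scalen: "(T ^^ n) (\<lambda>x. c * f x) = (\<lambda>x. c * (T ^^ n) f x)" for n c f
    by (induction n) (auto simp: scale)
  have nonnegn: "0 \<le> (T ^^ n) f x" if "\<And>y. 0 \<le> f y" for n f x
    by (induction n arbitrary: x) (auto simp: that nonneg)
  have onen: "(T ^^ n) (\<lambda>x. c) = (\<lambda>x. c)" for n c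
  proof (induction n)
    case (Suc n)
    then show ?case using scale[of c "\<lambda>x. 1"] by (simp add: one)
  qed simp
  have P_bound: "\<bar>P n f\<bar> \<le> B" if "\<And>x. \<bar>f x\<bar> \<le> B" for n f B
  proof -
    \<comment> \<open>Positivity at \<open>B + f\<close> and \<open>B - f\<close>, together with
      preservation of constants, gives the sup-norm bound.\<close>
    have "0 \<le> (T ^^ n) (\<lambda>x. B + f x) undefined" "0 \<le> (T ^^ n) (\<lambda>x. B + (-1) * f x) undefined"
      using that by (intro nonnegn; smt (verit))+
    then show ?thesis by (simp only: addn scalen onen P_def)
  qed
  \<comment> \<open>The value \<open>0\<close> at discontinuous functions, which may be unbounded,
    keeps every mean inside a product of compact intervals.\<close>
  define a where "a N f = (if continuous_on UNIV f then (\<Sum>n<Suc N. P n f) / real (Suc N) else 0)" for N f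
  have "\<forall>f :: 'x \<Rightarrow> real. \<exists>B. continuous_on UNIV f \<longrightarrow> B > 0 \<and> (\<forall>x. \<bar>f x\<bar> \<le> B)"
    using uniform_bound_continuous[OF comp] by metis
  then obtain B where "\<forall>f :: 'x \<Rightarrow> real. continuous_on UNIV f \<longrightarrow> B f > 0 \<and> (\<forall>x. \<bar>f x\<bar> \<le> B f)"
    by (rule choice[THEN exE])
  then have B: "B f > 0" "\<bar>f x\<bar> \<le> B f" if "continuous_on UNIV f" for f :: "'x \<Rightarrow> real" and x
    using that by blast+
  \<comment> \<open>The absolute value ensures that the interval contains \<open>0\<close> also at
    discontinuous \<open>f\<close>, where \<open>B f\<close> is arbitrary.\<close>
  define K where "K = (\<Pi>\<^sub>E f\<in>UNIV. {-\<bar>B f\<bar>..\<bar>B f\<bar>})"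
  have "compactin (product_topology (\<lambda>f. euclidean) UNIV) K"
    unfolding K_def by (subst compactin_PiE) simp
  then have K: "compact K" by (simp add: euclidean_product_topology)
  have aK: "a N \<in> K" for N
  proof -
    have "\<bar>a N f\<bar> \<le> \<bar>B f\<bar>" for f
    proof (cases "continuous_on UNIV f")
      case True
      then have "\<bar>P n f\<bar> \<le> B f" for n by (intro P_bound B(2))
      then have "\<bar>\<Sum>n<Suc N. P n f\<bar> \<le> (\<Sum>n<Suc N. B f)"
        by (intro order_trans[OF sum_abs] sum_mono)
      then have "\<bar>\<Sum>n<Suc N. P n f\<bar> \<le> real (Suc N) * B f" by simp
      then have "\<bar>\<Sum>n<Suc N. P n f\<bar> / real (Suc N) \<le> B f"
        by (subst divide_le_eq) (auto simp: mult.commute)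
      then show ?thesis using True by (simp add: a_def)
    qed (simp add: a_def)
    then show ?thesis unfolding K_def by (auto simp: abs_le_iff minus_le_iff)
  qed
  have "filtermap a sequentially \<noteq> bot" by (simp add: filtermap_bot_iff)
  moreover have "eventually (\<lambda>x. x \<in> K) (filtermap a sequentially)"
    by (simp add: eventually_filtermap aK)
  ultimately obtain \<Lambda> where \<Lambda>: "inf (nhds \<Lambda>) (filtermap a sequentially) \<noteq> bot"
    using K unfolding compact_filter by blast
  \<comment> \<open>The index set of the product is a space of functions, so a cluster point need
    not be the limit of a subsequence. The filter \<open>G\<close> refines
    \<open>sequentially\<close> and plays the role of a subnet.\<close>
  define G where "G = inf (filtercomap a (nhds \<Lambda>)) sequentially"
  have G: "G \<noteq> bot"
  proof
    assume "G = bot"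
    then obtain Q R where QR: "eventually Q (filtercomap a (nhds \<Lambda>))" "eventually R sequentially"
      "\<And>n. \<not> (Q n \<and> R n)"
      unfolding G_def trivial_limit_def eventually_inf by blast
    obtain Q' where Q': "eventually Q' (nhds \<Lambda>)" "\<And>n. Q' (a n) \<Longrightarrow> Q n"
      using QR(1) unfolding eventually_filtercomap by blast
    have "eventually (\<lambda>y. \<not> Q' y) (filtermap a sequentially)"
      unfolding eventually_filtermap using QR(2)
      by (rule eventually_mono) (use QR(3) Q'(2) in blast)
    then have "eventually (\<lambda>_. False) (inf (nhds \<Lambda>) (filtermap a sequentially))"
      using Q'(1) unfolding eventually_inf by blast
    then show False using \<Lambda> by (simp add: trivial_limit_def)
  qed
  have "filterlim a (nhds \<Lambda>) G"
    unfolding filterlim_def G_def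
    by (metis filtermap_filtercomap filtermap_mono inf_le1 order_trans)
  then have lim: "((\<lambda>n. a n f) \<longlongrightarrow> \<Lambda> f) G" for f
  proof -
    have "continuous_on UNIV (\<lambda>x :: ('x \<Rightarrow> real) \<Rightarrow> real. x f)"
      by (rule continuous_on_product_coordinates)
    then have "((\<lambda>x. x f) \<longlongrightarrow> \<Lambda> f) (at \<Lambda>)"
      by (simp add: continuous_on_def)
    then have "((\<lambda>x. x f) \<longlongrightarrow> \<Lambda> f) (nhds \<Lambda>)"
      using tendsto_at_iff_tendsto_nhds[of "\<lambda>x. x f" \<Lambda>] by simp
    from filterlim_compose[OF this \<open>filterlim a (nhds \<Lambda>) G\<close>] show ?thesis .
  qed
  have G_le: "G \<le> sequentially" by (simp add: G_def)
  show ?thesis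
  proof (rule that)
    show "positive_functional \<Lambda>"
    proof
      show "compact (UNIV :: 'x set)" by fact
      fix f :: "'x \<Rightarrow> real" assume f: "continuous_on UNIV f"
      show "\<Lambda> (\<lambda>x. f x + g x) = \<Lambda> f + \<Lambda> g" if g: "continuous_on UNIV g" for g
      proof (rule tendsto_unique[OF G lim])
        have "a n (\<lambda>x. f x + g x) = a n f + a n g" for n
          using f g continuous_on_add[OF f g]
          by (simp add: a_def P_def addn sum.distrib add_divide_distrib del: sum.lessThan_Suc)
        then show "((\<lambda>n. a n (\<lambda>x. f x + g x)) \<longlongrightarrow> \<Lambda> f + \<Lambda> g) G"
          by (simp add: tendsto_add lim)
      qed
      show "\<Lambda> (\<lambda>x. c * f x) = c * \<Lambda> f" for c
      proof (rule tendsto_unique[OF G lim])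
        have "a n (\<lambda>x. c * f x) = c * a n f" for n
          using f continuous_on_mult_left[OF f]
          by (simp add: a_def P_def scalen sum_distrib_left del: sum.lessThan_Suc)
        then show "((\<lambda>n. a n (\<lambda>x. c * f x)) \<longlongrightarrow> c * \<Lambda> f) G"
          by (simp add: tendsto_mult_left lim)
      qed
      show "0 \<le> \<Lambda> f" if "\<And>x. 0 \<le> f x"
      proof (rule tendsto_lowerbound[OF lim _ G], intro always_eventually allI)
        show "0 \<le> a n f" for n
          using nonnegn[OF that] by (auto simp: a_def P_def intro!: divide_nonneg_pos sum_nonneg add_nonneg_nonneg)
      qed
    next
      have "a n (\<lambda>x. 1) = 1" for n by (simp add: a_def P_def onen del: sum.lessThan_Suc)
      then show "\<Lambda> (\<lambda>x. 1) = 1"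
        by (intro tendsto_unique[OF G lim]) simp
    qed
    fix f :: "'x \<Rightarrow> real" assume f: "continuous_on UNIV f"
    have "((\<lambda>n. a n (T f) - a n f) \<longlongrightarrow> 0) sequentially"
    proof (rule Lim_null_comparison[OF always_eventually, OF allI])
      fix n
      \<comment> \<open>Applying \<open>T\<close> shifts the orbit by one step, so two boundary
        terms survive in the difference of means, and the division by \<open>Suc n\<close> makes it
        vanish in the limit.\<close>
      have "P i (T f) = P (Suc i) f" for i by (simp add: P_def funpow_Suc_right del: funpow.simps)
      then have "(\<Sum>i<Suc n. P i (T f)) - (\<Sum>i<Suc n. P i f) = P (Suc n) f - P 0 f"
        using sum_lessThan_telescope[of "\<lambda>i. P i f" "Suc n"] by (simp only: sum_subtractf)
      then have "a n (T f) - a n f = (P (Suc n) f - P 0 f) / real (Suc n)"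
        using f cont[OF f] by (simp add: a_def diff_divide_distrib[symmetric] del: sum.lessThan_Suc)
      moreover have "\<bar>P (Suc n) f - P 0 f\<bar> \<le> 2 * B f"
        using P_bound[of f "B f" "Suc n", OF B(2)[OF f]] P_bound[of f "B f" 0, OF B(2)[OF f]] by linarith
      ultimately show "norm (a n (T f) - a n f) \<le> 2 * B f * inverse (real (Suc n))"
        by (simp add: divide_inverse abs_mult mult_right_mono del: of_nat_Suc)
    next
      show "(\<lambda>n. 2 * B f * inverse (real (Suc n))) \<longlonglongrightarrow> 0"
        by (intro tendsto_mult_right_zero LIMSEQ_inverse_real_of_nat)
    qed
    then have "((\<lambda>n. a n (T f) - a n f) \<longlongrightarrow> 0) G" by (rule tendsto_mono[OF G_le])
    moreover have "((\<lambda>n. a n (T f) - a n f) \<longlongrightarrow> \<Lambda> (T f) - \<Lambda> f) G" by (intro tendsto_diff lim)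
    ultimately have "\<Lambda> (T f) - \<Lambda> f = 0" by (rule tendsto_unique[OF G, rotated])
    then show "\<Lambda> (T f) = \<Lambda> f" by simp
  qed
qed

section \<open>From the components to the correspondence\<close>

lemma continuous_on_sum_mset:
  fixes f :: "'i \<Rightarrow> 'a::topological_space \<Rightarrow> real"
  shows "(\<And>i. i \<in># M \<Longrightarrow> continuous_on A (f i)) \<Longrightarrow> continuous_on A (\<lambda>x. \<Sum>i\<in>#M. f i x)"
  by (induction M) (auto intro!: continuous_intros)

lemma sum_sum_mset_swap:
  fixes f :: "'i \<Rightarrow> 'a \<Rightarrow> nat" and g :: "'a \<Rightarrow> real"
  shows "(\<Sum>y\<in>A. real (\<Sum>i\<in>#M. f i y) * g y) = (\<Sum>i\<in>#M. \<Sum>y\<in>A. real (f i y) * g y)"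
  by (induction M) (simp_all add: distrib_right sum.distrib)

text \<open>\<open>G\<close> is the preimage of the whole compact base under a proper
  projection.\<close>

lemma compact_correspondence_component:
  fixes F :: "'x::topological_space correspondence"
  assumes "compact (UNIV :: 'x set)" "holomorphic_correspondence k \<A> F" "G \<in># F"
  shows "compact G"
proof -
  have "proper_map (top_of_set G) euclidean (snd :: 'x \<times> 'x \<Rightarrow> 'x)"
    using assms(2,3) by (auto simp: holomorphic_correspondence_def)
  then have "compactin (top_of_set G) {p \<in> topspace (top_of_set G). snd p \<in> UNIV}"
    by (rule compactin_proper_map_preimage) (simp add: assms(1))
  then show ?thesis by (simp add: compactin_subtopology)
qed

lemma
  assumes "integrable M f"
  shows integrable_scale_of_nat: "integrable (scale_measure (of_nat n) M) f"
    and integral_scale_of_nat: "integral\<^sup>L (scale_measure (of_nat n) M) f = real n * integral\<^sup>L M (f :: 'a \<Rightarrow> real)"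
proof -
  have eq: "scale_measure (of_nat n) M = density M (\<lambda>_. ennreal (real n))"
    by (rule measure_eqI) (auto simp: emeasure_density nn_integral_cmult_indicator ennreal_of_nat_eq_real_of_nat)
  have f: "f \<in> borel_measurable M" using assms by simp
  show "integrable (scale_measure (of_nat n) M) f"
    unfolding eq using assms f by (simp add: integrable_density)
  show "integral\<^sup>L (scale_measure (of_nat n) M) f = real n * integral\<^sup>L M f"
    unfolding eq using f by (simp add: integral_density)
qed

text \<open>The adjoint sum runs over points in the union of all component fibres, a fibre sum over
  one component's own fibre. Extending the latter to the union adds only terms of local degree
  \<open>0\<close>; the two sums may then be exchanged.\<close>

lemma adjoint_sum_eq_fibre_sums:
  assumes comp: "\<And>G. G \<in># F \<Longrightarrow> branched_component k \<A> G \<Omega> (\<delta> G)"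
  shows "adjoint_sum k \<A> F \<phi> x = (\<Sum>G\<in>#F. branched_component.fibre_sum k \<A> G (\<lambda>p. \<phi> (fst p)) x)"
proof -
  define A where "A = corr_adjoint F {x}"
  have A: "A = (\<Union>G\<in>set_mset F. fst ` {p \<in> G. snd p = x})"
    by (force simp: A_def corr_adjoint_def corr_support_def)
  have "finite A"
    unfolding A using branched_component.finite_fibres[OF comp] by auto
  have "(\<Sum>y\<in>A. real (local_degree k \<A> G (y, x)) * \<phi> y)
      = branched_component.fibre_sum k \<A> G (\<lambda>p. \<phi> (fst p)) x" if G: "G \<in># F" for G
  proof -
    interpret branched_component k \<A> G \<Omega> "\<delta> G" by (rule comp[OF G])
    have "fibre_sum (\<lambda>p. \<phi> (fst p)) x = (\<Sum>p\<in>{p \<in> G. snd p = x}. real (ldeg p) * \<phi> (fst p))"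
      by (simp add: fibre_sum_def)
    also have "\<dots> = (\<Sum>y\<in>fst ` {p \<in> G. snd p = x}. real (ldeg (y, x)) * \<phi> y)"
      by (subst sum.reindex) (auto simp: inj_on_def intro!: sum.cong)
    also have "\<dots> = (\<Sum>y\<in>A. real (ldeg (y, x)) * \<phi> y)"
    proof (rule sum.mono_neutral_left[OF \<open>finite A\<close>])
      show "fst ` {p \<in> G. snd p = x} \<subseteq> A" unfolding A using G by blast
      show "\<forall>y\<in>A - fst ` {p \<in> G. snd p = x}. real (ldeg (y, x)) * \<phi> y = 0"
      proof
        fix y assume "y \<in> A - fst ` {p \<in> G. snd p = x}"
        then have "(y, x) \<notin> G" by (auto simp: image_iff)
        then show "real (ldeg (y, x)) * \<phi> y = 0" by (simp add: local_degree_outside)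
      qed
    qed
    finally show ?thesis ..
  qed
  then have "(\<Sum>G\<in>#F. \<Sum>y\<in>A. real (local_degree k \<A> G (y, x)) * \<phi> y)
      = (\<Sum>G\<in>#F. branched_component.fibre_sum k \<A> G (\<lambda>p. \<phi> (fst p)) x)"
    by (intro arg_cong[where f = sum_mset] image_mset_cong)
  then show ?thesis
    unfolding adjoint_sum_def adjoint_mult_def A_def[symmetric] sum_sum_mset_swap .
qed

theorem proposition3p2:
  fixes k d :: nat
    and \<A> :: "'x::{t2_space, second_countable_topology} chart set"
    and F :: "'x correspondence"
  assumes "complex_manifold k \<A>"
    and "compact (UNIV :: 'x set)"
    and "holomorphic_correspondence k \<A> F"
    and "topological_degree k \<A> F d"
  shows "\<exists>\<mu> :: 'x measure. prob_space \<mu> \<and> sets \<mu> = sets borel \<and> pullback_invariant k \<A> F d \<mu>"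
proof -
  obtain \<Omega> \<delta> where \<Omega>: "\<Omega> \<noteq> {}" "zariski_open k \<A> \<Omega>"
      "\<And>G. G \<in># F \<Longrightarrow> holomorphic_covering k \<A> G \<Omega> (\<delta> G)" and d: "d = (\<Sum>G\<in>#F. \<delta> G)"
    using assms(4) unfolding topological_degree_def by blast
  have F: "snd ` G = UNIV" "finite {p \<in> G. snd p = x}" if "G \<in># F" for G x
    using assms(3) that by (auto simp: holomorphic_correspondence_def)
  have comp: "branched_component k \<A> G \<Omega> (\<delta> G)" if G: "G \<in># F" for G
    by unfold_locales
      (use assms(1) \<Omega> F[OF G] G compact_correspondence_component[OF assms(2,3) G] in auto)
  define S where "S = adjoint_sum k \<A> F"
  have S_eq: "S \<phi> x = (\<Sum>G\<in>#F. branched_component.fibre_sum k \<A> G (\<lambda>p. \<phi> (fst p)) x)" for \<phi> x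
    unfolding S_def by (rule adjoint_sum_eq_fibre_sums[OF comp])
  have S_cont: "continuous_on UNIV (S \<phi>)" if "continuous_on UNIV \<phi>" for \<phi>
  proof -
    have "continuous_on UNIV (\<lambda>p :: 'x \<times> 'x. \<phi> (fst p))"
      by (rule continuous_on_compose2[OF that continuous_on_fst[OF continuous_on_id]]) simp
    then show ?thesis
      unfolding S_eq[abs_def]
      by (intro continuous_on_sum_mset branched_component.continuous_on_fibre_sum[OF comp])
  qed
  have S_one: "S (\<lambda>_. 1) x = real d" for x
  proof -
    have "S (\<lambda>_. 1) x = (\<Sum>G\<in>#F. real (\<delta> G))"
      unfolding S_eq
      by (intro arg_cong[where f = sum_mset] image_mset_cong branched_component.fibre_sum_one[OF comp])
    also have "\<dots> = real d" unfolding d by (induction F) auto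
    finally show ?thesis .
  qed
  \<comment> \<open>Surjectivity of the second projection makes a fibre over \<open>\<Omega>\<close>
    non-empty, so division by \<open>d\<close> is legitimate.\<close>
  have "d > 0"
  proof -
    obtain G where G: "G \<in># F"
      using assms(3) by (auto simp: holomorphic_correspondence_def)
    obtain x where x: "x \<in> \<Omega>" using \<Omega>(1) by blast
    have "x \<in> snd ` G" using F(1)[OF G] by blast
    then have "card {p \<in> G. snd p = x} > 0" using F(2)[OF G] by (auto simp: card_gt_0_iff)
    then have "\<delta> G > 0"
      using branched_component.card_fib_UNIV[OF comp[OF G] x] by simp
    moreover have "\<delta> G \<le> d" unfolding d using G by (auto dest!: multi_member_split)
    ultimately show ?thesis by linarith
  qed
  \<comment> \<open>\<open>T\<close> averages over the \<open>d\<close> preimages and fixes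
    constants; invariance of \<open>\<Lambda>\<close> under \<open>T\<close> is the pullback
    equation tested on continuous functions.\<close>
  define T where "T \<phi> x = S \<phi> x / real d" for \<phi> x
  obtain \<Lambda> where \<Lambda>: "positive_functional \<Lambda>" "\<And>\<phi>. continuous_on UNIV \<phi> \<Longrightarrow> \<Lambda> (T \<phi>) = \<Lambda> \<phi>"
  proof (rule invariant_functional_exists[of T])
    show "continuous_on UNIV (T \<phi>)" if "continuous_on UNIV \<phi>" for \<phi>
      unfolding T_def using S_cont[OF that] by (intro continuous_intros) (use \<open>d > 0\<close> in auto)
    show "T (\<lambda>x. f x + g x) = (\<lambda>x. T f x + T g x)" for f g
      by (simp add: T_def S_def adjoint_sum_def distrib_left sum.distrib add_divide_distrib fun_eq_iff)
    show "T (\<lambda>x. c * f x) = (\<lambda>x. c * T f x)" for c f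
      by (simp add: T_def S_def adjoint_sum_def sum_distrib_left mult_ac fun_eq_iff)
    show "0 \<le> T f x" if "\<And>y. 0 \<le> f y" for f x
      unfolding T_def S_def adjoint_sum_def using that by (intro divide_nonneg_nonneg sum_nonneg) auto
    show "T (\<lambda>x. 1) = (\<lambda>x. 1)"
      using \<open>d > 0\<close> by (simp add: T_def S_one fun_eq_iff)
  qed (use assms(2) in auto)
  interpret positive_functional \<Lambda> by fact
  have "is_pullback k \<A> F rep_measure (scale_measure (of_nat d) rep_measure)"
    unfolding is_pullback_def
  proof (intro conjI allI impI)
    fix \<phi> :: "'x \<Rightarrow> real" assume "continuous_on UNIV \<phi> \<and> compact (closure {x. \<phi> x \<noteq> 0})"
    then have \<phi>: "continuous_on UNIV \<phi>" by blast
    note int = integrable_rep[OF \<phi>]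
    show "integrable (scale_measure (of_nat d) rep_measure) \<phi>"
      by (rule integrable_scale_of_nat[OF int])
    show "integrable rep_measure (adjoint_sum k \<A> F \<phi>)"
      using integrable_rep[OF S_cont[OF \<phi>]] by (simp add: S_def)
    have "\<Lambda> (T \<phi>) = \<Lambda> (S \<phi>) / real d"
      using scale[OF S_cont[OF \<phi>], of "1 / real d"] by (simp add: T_def[abs_def])
    then have "\<Lambda> (S \<phi>) = real d * \<Lambda> \<phi>"
      using \<Lambda>(2)[OF \<phi>] \<open>d > 0\<close> by (simp add: field_simps)
    then show "(LINT y|scale_measure (of_nat d) rep_measure. \<phi> y) = (LINT x|rep_measure. adjoint_sum k \<A> F \<phi> x)"
      using integral_scale_of_nat[OF int, of d] integral_rep[OF \<phi>] integral_rep[OF S_cont[OF \<phi>]]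
      by (simp add: S_def)
  qed simp
  then show ?thesis
    using prob_space_rep sets_rep unfolding pullback_invariant_def by blast
qed

end
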